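(* Let $\Lambda$, $(m_i,n_i,\mathcal{I}_i,N_i,B_i,C_i)_{i\in\Lambda}$, $(p_i)_{i\in\Lambda}$, $\mathbb{P}$ and $F_\omega$ be as in the context. Then for $\mathbb{P}$-almost every $\omega\in\Omega$, for every $\theta\in(0,1)$, \[ \dim_{\mathrm{A}}^\theta F_\omega=\begin{cases} \dfrac{1}{1-\theta}\left(\dfrac{\sum_{i\in\Lambda}p_i\log\left(B_iC_i^{\theta}N_i^{-\theta}\right)}{\sum_{i\in\Lambda}p_i\log m_i}+\dfrac{\sum_{i\in\Lambda}p_i\log\left(N_iB_i^{-1}C_i^{-\theta}\right)}{\sum_{i\in\Lambda}p_i\log n_i}\right), & 0<\theta\le \dfrac{\sum_{i}p_i\log m_i}{\sum_i p_i\log n_i},\\[3ex] \dfrac{\sum_{i}p_i\log B_i}{\sum_i p_i\log m_i}+\dfrac{\sum_i p_i\log C_i}{\sum_i p_i\log n_i}, & \dfrac{\sum_{i}p_i\log m_i}{\sum_i p_i\log n_i}<\theta<1. \end{cases} \]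
   Context: Let $\Lambda=\{1,\dots,|\Lambda|\}$ be a finite index set. For each $i\in\Lambda$ fix integers $n_i>m_i\ge 2$ and divide $[0,1]^2$ into the uniform grid of $m_i$ columns and $n_i$ rows, i.e. into $m_in_i$ closed rectangles of width $1/m_i$ and height $1/n_i$. Let $\mathcal{I}_i$ be a non-empty subset of these rectangles, $N_i=|\mathcal{I}_i|$, $B_i$ the number of distinct columns containing at least one rectangle of $\mathcal{I}_i$, and $C_i$ the maximum number of rectangles of $\mathcal{I}_i$ contained in a single column. For $j\in\mathcal{I}_i$ let $S_j$ be the unique orientation-preserving affine map (of the form $(x,y)\mapsto(x/m_i+a,\,y/n_i+b)$) mapping $[0,1]^2$ onto the rectangle $j$. Let $\Omega=\Lambda^{\mathbb{N}}$ and for $\omega=(\omega_1,\omega_2,\dots)\in\Omega$ let \[F_\omega=\bigcap_{k\ge1}\ \bigcup_{j_1\in\mathcal{I}_{\omega_1},\dots,j_k\in\mathcal{I}_{\omega_k}} S_{j_1}\circ\cdots\circ S_{j_k}([0,1]^2).\] Let $p_i\in(0,1)$ with $\sum_{i\in\Lambda}p_i=1$ and $\mathbb{P}=\prod_{k\in\mathbb{N}}\sum_{i\in\Lambda}p_i\delta_i$ the Bernoulli product measure on $\Omega$ (product topology). For bounded $E\subseteq\mathbb{R}^d$ and $r>0$, $N(E,r)$ denotes the minimal number of sets of diameter at most $r$ needed to cover $E$. For compact non-empty $F\subseteq\mathbb{R}^d$ and $\theta\in(0,1)$, the Assouad spectrum is \[\dim_{\mathrm{A}}^\theta F=\inf\Big\{\alpha:\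 \exists C>0\ \forall 0<R<1\ \forall x\in F,\ N\big(B(x,R)\cap F,R^{1/\theta}\big)\le C\big(R/R^{1/\theta}\big)^{\alpha}\Big\}.\] *)

theory Defs
  imports "HOL-Probability.Probability"
begin

text \<open>Grid rectangles are encoded as pairs (a,b) with a < m the column index and
  b < n the row index; the rectangle is [a/m,(a+1)/m] x [b/n,(b+1)/n].\<close>

definition Smap :: "nat \<Rightarrow> nat \<Rightarrow> nat \<times> nat \<Rightarrow> real \<times> real \<Rightarrow> real \<times> real" where
  "Smap m n j = (\<lambda>(x, y). (x / real m + real (fst j) / real m, y / real n + real (snd j) / real n))"

fun word_map :: "(nat \<Rightarrow> nat) \<Rightarrow> (nat \<Rightarrow> nat) \<Rightarrow> (nat \<Rightarrow> nat) \<Rightarrow> (nat \<Rightarrow> nat \<times> nat) \<Rightarrow> nat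
    \<Rightarrow> real \<times> real \<Rightarrow> real \<times> real" where
  "word_map m n \<omega> w 0 = id"
| "word_map m n \<omega> w (Suc k) = word_map m n \<omega> w k \<circ> Smap (m (\<omega> k)) (n (\<omega> k)) (w k)"

definition unit_square :: "(real \<times> real) set" where
  "unit_square = {0..1} \<times> {0..1}"

definition carpet :: "(nat \<Rightarrow> nat) \<Rightarrow> (nat \<Rightarrow> nat) \<Rightarrow> (nat \<Rightarrow> (nat \<times> nat) set) \<Rightarrow> (nat \<Rightarrow> nat)
    \<Rightarrow> (real \<times> real) set" where
  "carpet m n I \<omega> = (\<Inter>k. \<Union>{word_map m n \<omega> w k ` unit_square | w. \<forall>t<k. w t \<in> I (\<omega> t)})"

definition numN :: "(nat \<times> nat) set \<Rightarrow> nat" where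
  "numN J = card J"

definition numB :: "(nat \<times> nat) set \<Rightarrow> nat" where
  "numB J = card (fst ` J)"

definition numC :: "(nat \<times> nat) set \<Rightarrow> nat" where
  "numC J = Max ((\<lambda>a. card {b. (a, b) \<in> J}) ` fst ` J)"

definition cover_number :: "'a::metric_space set \<Rightarrow> real \<Rightarrow> nat" where
  "cover_number E r = (LEAST k. \<exists>C. finite C \<and> card C = k \<and> E \<subseteq> \<Union>C \<and>
      (\<forall>U\<in>C. bounded U \<and> diameter U \<le> r))"

definition assouad_spectrum :: "real \<Rightarrow> 'a::metric_space set \<Rightarrow> real" where
  "assouad_spectrum \<theta> F = Inf {\<alpha>. \<exists>c>0. \<forall>R. 0 < R \<and> R < 1 \<longrightarrow> (\<forall>x\<in>F.
      real (cover_number (ball x R \<inter> F) (R powr (1 / \<theta>))) \<le> c * (R / R powr (1 / \<theta>)) powr \<alpha>)}"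

definition letter_pmf :: "nat \<Rightarrow> (nat \<Rightarrow> real) \<Rightarrow> nat pmf" where
  "letter_pmf L p = embed_pmf (\<lambda>i. if i \<in> {1..L} then p i else 0)"

definition bernoulli_measure :: "nat \<Rightarrow> (nat \<Rightarrow> real) \<Rightarrow> (nat \<Rightarrow> nat) measure" where
  "bernoulli_measure L p = PiM UNIV (\<lambda>_. measure_pmf (letter_pmf L p))"

end

theory Submission
  imports Defs "HOL-Real_Asymp.Real_Asymp"
begin

text \<open>Almost surely all letters occur with their expected frequencies (Hoeffding and Borel-Cantelli),
  and the formula holds for every such \<open>\<omega>\<close>. An approximate square of side \<open>R\<close> fixes the columns of
  the first \<open>k(R)\<close> levels and the rows of the first \<open>l(R)\<close> levels, where the product of the first
  \<open>k(R)\<close> numbers \<open>m\<close>, and of the first \<open>l(R)\<close> numbers \<open>n\<close>, is about \<open>1 / R\<close>. Passing to squares of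
  side \<open>r = R powr (1 / \<theta>)\<close>, the number of subsquares gains at each level at most the factor \<open>C\<close> while the
  column is prescribed and the row becomes visible, \<open>N\<close> while both become visible, and \<open>B\<close> while
  only the column does; always descending through fullest columns attains this bound. The case
  distinction in \<open>\<theta>\<close> is whether \<open>k(R)\<close> or \<open>l(r)\<close> is larger.\<close>

section \<open>Letter frequencies\<close>

text \<open>Independence means that the joint law is the product of the marginal laws. Here the
  joint law is \<open>PiM I M\<close> itself, because restricting to \<open>I\<close> changes no
  point of its space.\<close>

lemma indep_vars_PiM_coordinates:
  assumes "\<And>i. i \<in> I \<Longrightarrow> prob_space (M i)" "I \<noteq> {}"
  shows "prob_space.indep_vars (PiM I M) M (\<lambda>i \<omega>. \<omega> i) I"
proof -
  interpret prob_space "PiM I M" by (rule prob_space_PiM) (use assms in auto)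
  have "distr (PiM I M) (PiM I M) (\<lambda>x. restrict (\<lambda>i. x i) I) = distr (PiM I M) (PiM I M) (\<lambda>x. x)"
    by (rule distr_cong) (auto simp: space_PiM)
  also have "\<dots> = PiM I (\<lambda>i. distr (PiM I M) (M i) (\<lambda>x. x i))"
    unfolding distr_id by (rule PiM_cong) (auto simp: distr_PiM_component assms)
  finally show ?thesis
    by (subst indep_vars_iff_distr_eq_PiM') (auto simp: assms)
qed

text \<open>Strong law for the indicators of one letter: Hoeffding bounds the probability of a
  deviation \<open>e\<close> by a geometric sequence in \<open>k\<close>, so Borel-Cantelli excludes
  it eventually, and the countably many \<open>e = 1 / (j + 1)\<close> suffice.\<close>

lemma AE_frequency:
  fixes q :: "'a pmf" and i :: 'a
  defines "P \<equiv> PiM (UNIV::nat set) (\<lambda>_. measure_pmf q)"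
  shows "AE \<omega> in P. (\<lambda>k. (\<Sum>t<k. of_bool (\<omega> t = i)) / real k) \<longlonglongrightarrow> pmf q i"
proof -
  interpret prob_space P unfolding P_def by (rule prob_space_PiM) (rule measure_pmf.prob_space_axioms)
  define X :: "nat \<Rightarrow> (nat \<Rightarrow> 'a) \<Rightarrow> real" where "X = (\<lambda>t \<omega>. of_bool (\<omega> t = i))"
  have comp: "distr P (measure_pmf q) (\<lambda>\<omega>. \<omega> t) = measure_pmf q" for t
    unfolding P_def by (rule distr_PiM_component) (auto intro: measure_pmf.prob_space_axioms)
  have proj: "(\<lambda>\<omega>. \<omega> t) \<in> measurable P (measure_pmf q)" for t
    unfolding P_def by (rule measurable_component_singleton) simp
  have [measurable]: "X t \<in> borel_measurable P" for t
    unfolding X_def by (rule measurable_compose[OF proj]) simp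
  have dX: "distr P borel (X t) = distr (measure_pmf q) borel (\<lambda>a. of_bool (a = i))" for t
  proof -
    have "distr (measure_pmf q) borel (\<lambda>a. of_bool (a = i)) = 
        distr (distr P (measure_pmf q) (\<lambda>\<omega>. \<omega> t)) borel (\<lambda>a. of_bool (a = i) :: real)"
      by (simp add: comp)
    also have "\<dots> = distr P borel (X t)"
      by (subst distr_distr) (use proj[of t] in \<open>auto simp: X_def comp_def\<close>)
    finally show ?thesis ..
  qed
  have eX: "expectation (X t) = pmf q i" for t
  proof -
    have "expectation (X t) = integral\<^sup>L (distr P (measure_pmf q) (\<lambda>\<omega>. \<omega> t)) (\<lambda>a. indicator {i} a)"
      by (subst integral_distr[OF proj]) (auto simp: X_def of_bool_def indicator_def intro!: Bochner_Integration.integral_cong)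
    also have "\<dots> = pmf q i" by (simp add: comp pmf.rep_eq)
    finally show ?thesis .
  qed
  have indX: "indep_vars (\<lambda>_. borel) X UNIV"
    unfolding X_def
    by (rule indep_vars_compose2[where M' = "\<lambda>_. measure_pmf q"])
       (auto simp: P_def intro!: indep_vars_PiM_coordinates measure_pmf.prob_space_axioms)
  have tail: "AE \<omega> in P. eventually (\<lambda>k. \<bar>(\<Sum>t<k. X t \<omega>) / real k - pmf q i\<bar> < e) sequentially"
    if e: "e > 0" for e
  proof -
    define A where "A = (\<lambda>k. {\<omega> \<in> space P. \<bar>(\<Sum>t<k. X t \<omega>) - real k * pmf q i\<bar> \<ge> real k * e})"
    have [measurable]: "A k \<in> sets P" for k unfolding A_def by measurable
    \<comment> \<open>The exponent in Hoeffding's inequality divides by \<open>k\<close>, so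
      \<open>k = 0\<close> is treated apart; the bound is then the trivial \<open>2\<close>.\<close>
    have bd: "prob (A k) \<le> 2 * exp (- 2 * e^2) ^ k" for k
    proof (cases "k = 0")
      case True
      have "prob (A k) \<le> 2" using prob_le_1[of "A k"] by linarith
      thus ?thesis using True by simp
    next
      case False
      interpret H: Hoeffding_ineq_iid P "{..<k}" X "X 0" 0 1 "pmf q i"
      proof unfold_locales
        show "AE x in P. X 0 x \<in> {0..1}" by (simp add: X_def)
        show "indep_vars (\<lambda>_. borel) X {..<k}" by (rule indep_vars_subset[OF indX]) simp
      qed (simp_all add: dX eX)
      have "prob (A k) \<le> 2 * exp (- 2 * (real k * e)\<^sup>2 / (real k * (1 - 0)\<^sup>2))"
        unfolding A_def using H.Hoeffding_ineq_abs_ge[of "real k * e"] e False by (auto simp: lessThan_empty_iff)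
      also have "- 2 * (real k * e)\<^sup>2 / (real k * (1 - 0)\<^sup>2) = real k * (- 2 * e^2)"
        using False by (simp add: power2_eq_square field_simps)
      finally show ?thesis by (simp only: exp_of_nat_mult)
    qed
    have "AE \<omega> in P. eventually (\<lambda>k. \<omega> \<in> space P - A k) sequentially"
    proof (rule borel_cantelli_AE1)
      show "summable (\<lambda>k. prob (A k))"
      proof (rule summable_comparison_test')
        show "summable (\<lambda>k. 2 * exp (- 2 * e^2) ^ k)"
          by (intro summable_mult summable_geometric) (use e in simp)
        show "norm (prob (A k)) \<le> 2 * exp (- 2 * e^2) ^ k" if "k \<ge> 0" for k
          using bd[of k] by simp
      qed
    qed (auto simp: emeasure_eq_measure)
    thus ?thesis
    proof eventually_elim
      case (elim \<omega>)
      show ?case using elim eventually_gt_at_top[of 0]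
      proof eventually_elim
        case (elim k)
        have "\<bar>(\<Sum>t<k. X t \<omega>) - real k * pmf q i\<bar> < real k * e"
          using elim(1) by (auto simp: A_def)
        moreover have "(\<Sum>t<k. X t \<omega>) - real k * pmf q i = real k * ((\<Sum>t<k. X t \<omega>) / real k - pmf q i)"
          using elim(2) by (simp add: right_diff_distrib)
        ultimately show ?case using elim(2) by (simp add: abs_mult)
      qed
    qed
  qed
  have "AE \<omega> in P. \<forall>j::nat. eventually (\<lambda>k. \<bar>(\<Sum>t<k. X t \<omega>) / real k - pmf q i\<bar> < 1 / real (Suc j)) sequentially"
    by (subst AE_all_countable) (intro allI tail, simp)
  thus ?thesis
  proof eventually_elim
    case (elim \<omega>)
    show ?case
    proof (rule tendstoI)
      fix e :: real assume "e > 0"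
      then obtain j where j: "1 / real (Suc j) < e"
        using nat_approx_posE by (metis)
      show "eventually (\<lambda>k. dist ((\<Sum>t<k. of_bool (\<omega> t = i)) / real k) (pmf q i) < e) sequentially"
        using elim[rule_format, of j] by eventually_elim (use j in \<open>simp add: dist_real_def X_def\<close>)
    qed
  qed
qed

lemma pmf_letter_pmf:
  assumes p_pos: "\<And>i. i \<in> {1..L} \<Longrightarrow> 0 \<le> p i" and p_sum: "(\<Sum>i\<in>{1..L}. p i) = 1"
  shows "pmf (letter_pmf L p) i = (if i \<in> {1..L} then p i else 0)"
  unfolding letter_pmf_def
proof (rule pmf_embed_pmf)
  have "(\<Sum>x = 1..L. ennreal (p x)) = ennreal (\<Sum>x = 1..L. p x)"
    by (rule sum_ennreal) (rule p_pos)
  hence "(\<Sum>x = 1..L. ennreal (p x)) = 1" by (simp only: p_sum ennreal_1)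
  thus "(\<integral>\<^sup>+ i. ennreal (if i \<in> {1..L} then p i else 0) \<partial>count_space UNIV) = 1"
    by (subst nn_integral_count_space'[of "{1..L}"])
       (use assms in \<open>auto simp del: One_nat_def\<close>)
qed (use assms in auto)

text \<open>The quantifier over \<open>f\<close> stands inside the almost-sure statement: only the
  countably many letter frequencies need a null set, and each average of \<open>f\<close> is a
  finite linear combination of them. Hence all logarithms in the formula, and all \<theta>, share
  one exceptional set.\<close>

lemma AE_bernoulli_averages:
  assumes p_pos: "\<And>i. i \<in> {1..L} \<Longrightarrow> 0 \<le> p i" and p_sum: "(\<Sum>i\<in>{1..L}. p i) = 1"
  shows "AE \<omega> in bernoulli_measure L p. (\<forall>t. \<omega> t \<in> {1..L}) \<and>
     (\<forall>f. (\<lambda>k. (\<Sum>t<k. f (\<omega> t)) / real k) \<longlonglongrightarrow> (\<Sum>i\<in>{1..L}. p i * f i))"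
proof -
  let ?P = "bernoulli_measure L p"
  have "AE \<omega> in ?P. \<forall>i. (\<lambda>k. (\<Sum>t<k. of_bool (\<omega> t = i)) / real k) \<longlonglongrightarrow> pmf (letter_pmf L p) i"
    unfolding bernoulli_measure_def by (subst AE_all_countable) (intro allI AE_frequency)
  moreover have "AE \<omega> in ?P. \<forall>t. \<omega> t \<in> {1..L}"
  proof (subst AE_all_countable, intro allI)
    fix t
    have "set_pmf (letter_pmf L p) \<subseteq> {1..L}"
      by (auto simp: set_pmf_eq pmf_letter_pmf[of L p, OF assms] simp del: atLeastAtMost_iff One_nat_def split: if_splits)
    hence "AE x in measure_pmf (letter_pmf L p). x \<in> {1..L}"
      by (auto simp: AE_measure_pmf_iff)
    thus "AE \<omega> in ?P. \<omega> t \<in> {1..L}"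
      unfolding bernoulli_measure_def
      by (intro AE_PiM_component) (auto intro: measure_pmf.prob_space_axioms)
  qed
  ultimately show ?thesis
  proof eventually_elim
    case (elim \<omega>)
    have "(\<lambda>k. (\<Sum>t<k. f (\<omega> t)) / real k) \<longlonglongrightarrow> (\<Sum>i\<in>{1..L}. p i * f i)" for f :: "nat \<Rightarrow> real"
    proof -
      have "(\<Sum>t<k. f (\<omega> t)) / real k = (\<Sum>i\<in>{1..L}. (\<Sum>t<k. of_bool (\<omega> t = i)) / real k * f i)" for k
      proof -
        have "f (\<omega> t) = (\<Sum>i\<in>{1..L}. of_bool (\<omega> t = i) * f i)" for t
          using elim(2) by (simp add: of_bool_def if_distrib if_distribR cong: if_cong)
        hence "(\<Sum>t<k. f (\<omega> t)) = (\<Sum>i\<in>{1..L}. \<Sum>t<k. of_bool (\<omega> t = i) * f i)"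
          by (simp only: sum.swap[of _ "{..<k}"])
        thus ?thesis by (simp add: sum_divide_distrib sum_distrib_right)
      qed
      moreover have "(\<lambda>k. (\<Sum>i\<in>{1..L}. (\<Sum>t<k. of_bool (\<omega> t = i)) / real k * f i))
          \<longlonglongrightarrow> (\<Sum>i\<in>{1..L}. pmf (letter_pmf L p) i * f i)"
        by (intro tendsto_intros elim(1)[rule_format])
      moreover have "(\<Sum>i\<in>{1..L}. pmf (letter_pmf L p) i * f i) = (\<Sum>i\<in>{1..L}. p i * f i)"
        by (intro sum.cong refl, subst pmf_letter_pmf[of L p, OF assms]) auto
      ultimately show ?thesis by (simp only:)
    qed
    with elim show ?case by blast
  qed
qed

section \<open>Approximate squares\<close>

definition radix :: "(nat \<Rightarrow> nat) \<Rightarrow> nat \<Rightarrow> nat" where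
  "radix q k = (\<Prod>t<k. q t)"

text \<open>The first digit is the most significant one, so that later digits refine the
  position.\<close>

fun digit_val :: "(nat \<Rightarrow> nat) \<Rightarrow> (nat \<Rightarrow> nat) \<Rightarrow> nat \<Rightarrow> nat" where
  "digit_val q d 0 = 0"
| "digit_val q d (Suc k) = digit_val q d k * q k + d k"

text \<open>Denominators are cleared, so that cell indices and rescaled distances compare directly;
  the interval itself appears in \<open>cell_eq_interval\<close>.\<close>

definition cell :: "(nat \<Rightarrow> nat) \<Rightarrow> (nat \<Rightarrow> nat) \<Rightarrow> nat \<Rightarrow> real set" where
  "cell q d k = {s. real (digit_val q d k) \<le> s * radix q k \<and> s * radix q k \<le> real (digit_val q d k) + 1}"

lemma radix_0 [simp]: "radix q 0 = 1"
  and radix_Suc [simp]: "radix q (Suc k) = radix q k * q k"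
  by (simp_all add: radix_def)

lemma radix_pos: "(\<And>t. 0 < q t) \<Longrightarrow> 0 < radix q k"
  by (simp add: radix_def prod_pos)

lemma digit_val_cong: "(\<And>t. t < k \<Longrightarrow> d t = d' t) \<Longrightarrow> digit_val q d k = digit_val q d' k"
  by (induction k) auto

text \<open>Division with remainder by the last base recovers the last digit and the index formed by
  the earlier ones.\<close>

lemma digit_val_inj:
  assumes "digit_val q d k = digit_val q d' k" "\<And>t. t < k \<Longrightarrow> d t < q t" "\<And>t. t < k \<Longrightarrow> d' t < q t" "t < k"
  shows "d t = d' t"
  using assms
proof (induction k arbitrary: t)
  case (Suc k)
  have less: "d k < q k" "d' k < q k" using Suc.prems by auto
  have "(digit_val q d k * q k + d k) div q k = (digit_val q d' k * q k + d' k) div q k"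
    "(digit_val q d k * q k + d k) mod q k = (digit_val q d' k * q k + d' k) mod q k"
    using Suc.prems(1) by simp_all
  hence "digit_val q d k = digit_val q d' k" "d k = d' k" using less by simp_all
  moreover from this have "d t = d' t" if "t < k" using Suc.IH[of t] Suc.prems that by auto
  ultimately show ?case using Suc.prems(4) by (cases "t = k") auto
qed simp

lemma cell_cong: "(\<And>t. t < k \<Longrightarrow> d t = d' t) \<Longrightarrow> cell q d k = cell q d' k"
  using digit_val_cong[of k d d' q] by (simp add: cell_def)

lemma cell_Suc_subset:
  assumes "d k < q k" shows "cell q d (Suc k) \<subseteq> cell q d k"
proof
  fix s assume s: "s \<in> cell q d (Suc k)"
  have q: "real (q k) > 0" using assms by simp
  have "real (digit_val q d k) * q k \<le> (s * radix q k) * q k"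
    using s by (simp add: cell_def algebra_simps)
  \<comment> \<open>By integrality even the last subinterval ends no later than its parent.\<close>
  moreover have "real (d k) + 1 \<le> real (q k)" using assms by linarith
  hence "(s * radix q k) * q k \<le> (real (digit_val q d k) + 1) * q k"
    using s by (simp add: cell_def algebra_simps)
  ultimately show "s \<in> cell q d k"
    using q by (simp add: cell_def)
qed

lemma cell_antimono:
  assumes "k \<le> k'" "\<And>t. t < k' \<Longrightarrow> d t < q t"
  shows "cell q d k' \<subseteq> cell q d k"
  using assms
proof (induction k' rule: dec_induct)
  case (step j)
  have "cell q d (Suc j) \<subseteq> cell q d j" using step by (intro cell_Suc_subset) auto
  also have "\<dots> \<subseteq> cell q d k" using step by auto
  finally show ?case .
qed simp

lemma cell_dist:
  assumes "s \<in> cell q d k" "s' \<in> cell q d k" shows "\<bar>s - s'\<bar> * radix q k \<le> 1"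
proof -
  have "\<bar>s - s'\<bar> * radix q k = \<bar>s * radix q k - s' * radix q k\<bar>"
    by (simp add: abs_mult left_diff_distrib[symmetric])
  thus ?thesis using assms by (auto simp: cell_def)
qed

text \<open>After rescaling by \<open>radix q k\<close>, cells have length 1 and their indices are
  the left ends. A point exceeds its index by at most 1, which accounts for the \<open>+ 1\<close>.
  The estimate is one-sided and is used in both orders.\<close>

lemma digit_val_dist:
  assumes "s \<in> cell q d k" "s' \<in> cell q d' k" "\<bar>s - s'\<bar> * radix q k \<le> real H"
  shows "digit_val q d k \<le> digit_val q d' k + (H + 1)"
proof -
  have "s * radix q k - s' * radix q k \<le> \<bar>s - s'\<bar> * radix q k"
    by (simp add: left_diff_distrib[symmetric] mult_right_mono)
  hence "real (digit_val q d k) \<le> real (digit_val q d' k + (H + 1))"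
    using assms by (auto simp: cell_def)
  thus ?thesis by (simp only: of_nat_le_iff)
qed

lemma cell_eq_interval:
  assumes "\<And>t. 0 < q t"
  shows "cell q d k = {digit_val q d k / radix q k .. (digit_val q d k + 1) / radix q k}"
  using radix_pos[of q k] assms by (auto simp: cell_def field_simps)

lemma cells_common_point:
  assumes "\<And>t. d t < q t"
  shows "\<exists>s. \<forall>k. s \<in> cell q d k"
proof -
  have q: "0 < q t" for t using assms[of t] by simp
  have "\<Inter>(range (cell q d)) \<noteq> {}"
  proof (rule compact_nest)
    show "compact (cell q d k)" for k by (subst cell_eq_interval) (auto simp: q)
    show "cell q d k \<noteq> {}" for k using radix_pos[of q k] q
      by (subst cell_eq_interval) (auto simp: divide_right_mono)
    show "cell q d k' \<subseteq> cell q d k" if "k \<le> k'" for k k'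
      using cell_antimono[OF that] assms by auto
  qed
  thus ?thesis by auto
qed

text \<open>\<open>A\<close> lies in the interval of length \<open>h\<close> that starts at its
  least element. This turns a spread of cell indices into a number of cells.\<close>

lemma nat_set_bounded_spread:
  fixes A :: "nat set"
  assumes "\<And>x y. x \<in> A \<Longrightarrow> y \<in> A \<Longrightarrow> x \<le> y + h"
  shows "finite A" "card A \<le> h + 1"
proof -
  have sub: "A \<subseteq> {Inf A..Inf A + h}"
  proof
    fix x assume x: "x \<in> A"
    hence "Inf A \<in> A" by (intro Inf_nat_def1) auto
    thus "x \<in> {Inf A..Inf A + h}" using assms[of x "Inf A"] x by (auto intro: cInf_lower)
  qed
  show "finite A" by (rule finite_subset[OF sub]) simp
  show "card A \<le> h + 1" using card_mono[OF _ sub] by simp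
qed

section \<open>Distances in the plane and the carpet in terms of digits\<close>

lemma dist_prod_le: "dist z z' \<le> \<bar>fst z - fst z'\<bar> + \<bar>snd z - snd z'\<bar>"
  for z z' :: "real \<times> real"
  by (simp add: dist_prod_def dist_real_def sqrt_sum_squares_le_sum_abs[THEN order_trans])

lemma abs_fst_le_dist: "\<bar>fst z - fst z'\<bar> \<le> dist z z'"
  and abs_snd_le_dist: "\<bar>snd z - snd z'\<bar> \<le> dist z z'" for z z' :: "real \<times> real"
  using dist_fst_le[of z z'] dist_snd_le[of z z'] by (simp_all add: dist_real_def)

text \<open>The newest map is applied first and so supplies the least significant digits; the two
  coordinates evolve separately.\<close>

lemma word_map_eq:
  fixes m n :: "nat \<Rightarrow> nat" and x y :: real
  assumes "\<And>t. 0 < m (\<omega> t)" "\<And>t. 0 < n (\<omega> t)"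
  shows "word_map m n \<omega> w k (x, y) =
    ((digit_val (m \<circ> \<omega>) (fst \<circ> w) k + x) / radix (m \<circ> \<omega>) k,
     (digit_val (n \<circ> \<omega>) (snd \<circ> w) k + y) / radix (n \<circ> \<omega>) k)"
proof (induction k arbitrary: x y)
  case (Suc k)
  show ?case using Suc assms[of k]
    by (simp add: Smap_def split_beta add_divide_distrib[symmetric])
       (simp add: field_simps)
qed simp

lemma mem_word_map_image:
  fixes m n :: "nat \<Rightarrow> nat"
  assumes "\<And>t. 0 < m (\<omega> t)" "\<And>t. 0 < n (\<omega> t)"
  shows "z \<in> word_map m n \<omega> w k ` unit_square \<longleftrightarrow>
    fst z \<in> cell (m \<circ> \<omega>) (fst \<circ> w) k \<and> snd z \<in> cell (n \<circ> \<omega>) (snd \<circ> w) k"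
proof -
  define X Y where "X = real (digit_val (m \<circ> \<omega>) (fst \<circ> w) k)" "Y = real (digit_val (n \<circ> \<omega>) (snd \<circ> w) k)"
  define M N where "M = real (radix (m \<circ> \<omega>) k)" "N = real (radix (n \<circ> \<omega>) k)"
  have pos: "M > 0" "N > 0" using radix_pos[of "m \<circ> \<omega>" k] radix_pos[of "n \<circ> \<omega>" k] assms
    by (auto simp: M_N_def)
  have "z \<in> word_map m n \<omega> w k ` unit_square \<longleftrightarrow>
     (\<exists>x y. 0 \<le> x \<and> x \<le> 1 \<and> 0 \<le> y \<and> y \<le> 1 \<and> z = ((X + x) / M, (Y + y) / N))"
    unfolding unit_square_def image_iff Bex_def
    by (auto simp: word_map_eq[of m \<omega> n, OF assms] X_Y_def M_N_def)
  also have "\<dots> \<longleftrightarrow> (X \<le> fst z * M \<and> fst z * M \<le> X + 1) \<and> (Y \<le> snd z * N \<and> snd z * N \<le> Y + 1)"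
  proof
    assume R: "(X \<le> fst z * M \<and> fst z * M \<le> X + 1) \<and> (Y \<le> snd z * N \<and> snd z * N \<le> Y + 1)"
    show "\<exists>x y. 0 \<le> x \<and> x \<le> 1 \<and> 0 \<le> y \<and> y \<le> 1 \<and> z = ((X + x) / M, (Y + y) / N)"
      by (rule exI[of _ "fst z * M - X"], rule exI[of _ "snd z * N - Y"])
         (use R pos in \<open>auto simp: prod_eq_iff\<close>)
  qed (use pos in auto)
  finally show ?thesis by (simp add: cell_def X_Y_def M_N_def)
qed

text \<open>The parameters are the grids met along one fixed word: \<open>m \<circ> \<omega>\<close>, \<open>n \<circ> \<omega>\<close>, \<open>I \<circ> \<omega>\<close>.\<close>

locale grid_sequence =
  fixes m n :: "nat \<Rightarrow> nat" and I :: "nat \<Rightarrow> (nat \<times> nat) set" and b :: nat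
  assumes m_ge: "2 \<le> m t" and m_less_n: "m t < n t" and n_le: "n t \<le> b"
    and I_sub: "I t \<subseteq> {..<m t} \<times> {..<n t}" and I_ne: "I t \<noteq> {}"
begin

text \<open>The word may change with \<open>k\<close>, as in the intersection of unions that defines
  \<open>carpet\<close>. Membership is phrased by cells, so that all counting concerns
  digits.\<close>

definition limit_set :: "(real \<times> real) set" where
  "limit_set = {z. \<forall>k. \<exists>w. (\<forall>t<k. w t \<in> I t) \<and>
     fst z \<in> cell m (fst \<circ> w) k \<and> snd z \<in> cell n (snd \<circ> w) k}"

lemma m_pos: "0 < m t" and n_pos: "0 < n t"
  using m_ge[of t] m_less_n[of t] by auto

lemma finite_I: "finite (I t)"
  using I_sub by (rule finite_subset) simp

lemma I_digits: "j \<in> I t \<Longrightarrow> fst j < m t" "j \<in> I t \<Longrightarrow> snd j < n t"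
  using I_sub[of t] by auto

lemma finite_fiber: "finite {y. (x, y) \<in> I t}"
  by (rule finite_subset[of _ "snd ` I t"]) (force simp: finite_I)+

lemma word_in_limit_set:
  assumes "\<And>t. w t \<in> I t"
  shows "\<exists>z\<in>limit_set. \<forall>k. fst z \<in> cell m (fst \<circ> w) k \<and> snd z \<in> cell n (snd \<circ> w) k"
proof -
  obtain x where "\<forall>k. x \<in> cell m (fst \<circ> w) k"
    using cells_common_point[of "fst \<circ> w" m] I_digits assms by fastforce
  moreover obtain y where "\<forall>k. y \<in> cell n (snd \<circ> w) k"
    using cells_common_point[of "snd \<circ> w" n] I_digits assms by fastforce
  ultimately show ?thesis using assms by (intro bexI[of _ "(x, y)"]) (auto simp: limit_set_def)
qed

lemma card_fiber_le_numC:
  assumes "(x, y) \<in> I t" shows "card {y. (x, y) \<in> I t} \<le> numC (I t)"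
  unfolding numC_def using assms by (intro Max_ge) (auto simp: finite_I image_iff intro!: bexI)

lemma numC_attained: "\<exists>x y. (x, y) \<in> I t \<and> card {y. (x, y) \<in> I t} = numC (I t)"
proof -
  have "numC (I t) \<in> (\<lambda>x. card {y. (x, y) \<in> I t}) ` fst ` I t"
    unfolding numC_def using I_ne by (intro Max_in) (auto simp: finite_I)
  thus ?thesis by force
qed

text \<open>An approximate square of type \<open>(k, l)\<close>, with \<open>l \<le> k\<close>, is the set of points sharing the columns
  of the first \<open>k\<close> levels and the rows of the first \<open>l\<close> levels. The digits at level \<open>t\<close> occurring
  in the finer squares of type \<open>(k', l')\<close> inside it are those in \<open>visible l k l' x y t\<close>, where
  a row that is too fine to be seen is recorded as \<open>0\<close>.\<close>

definition observe :: "nat \<Rightarrow> nat \<Rightarrow> nat \<times> nat \<Rightarrow> nat \<times> nat" where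
  "observe l' t j = (fst j, if t < l' then snd j else 0)"

definition visible :: "nat \<Rightarrow> nat \<Rightarrow> nat \<Rightarrow> (nat \<Rightarrow> nat) \<Rightarrow> (nat \<Rightarrow> nat) \<Rightarrow> nat \<Rightarrow> (nat \<times> nat) set" where
  "visible l k l' x y t = observe l' t ` {j \<in> I t. (t < k \<longrightarrow> fst j = x t) \<and> (t < l \<longrightarrow> snd j = y t)}"

text \<open>The maximum of \<open>card (visible l k l' x y t)\<close> for \<open>l \<le> k\<close>
  and \<open>l \<le> l'\<close>, attained when column \<open>x t\<close> is fullest. The tests are
  read in order: the third clause concerns \<open>t \<ge> k\<close>, the last two
  \<open>t \<ge> l'\<close>.\<close>

definition branching :: "nat \<Rightarrow> nat \<Rightarrow> nat \<Rightarrow> nat \<Rightarrow> nat" where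
  "branching l k l' t = (if t < l then 1 else if t < k \<and> t < l' then numC (I t)
     else if t < l' then numN (I t) else if t < k then 1 else numB (I t))"

lemma finite_visible: "finite (visible l k l' x y t)"
  by (simp add: visible_def finite_I)

text \<open>The fibre over \<open>x t\<close> is kept exactly, since both directions need it: it is
  at most \<open>numC (I t)\<close> for covers, and equal to it once fullest columns are
  chosen.\<close>

lemma card_visible:
  assumes "(x t, y t) \<in> I t" "l \<le> k" "l \<le> l'"
  shows "card (visible l k l' x y t) = (if t < l then 1 else if t < k \<and> t < l' then card {y. (x t, y) \<in> I t}
     else if t < l' then numN (I t) else if t < k then 1 else numB (I t))"
proof -
  consider "t < l" | "l \<le> t" "t < k" "t < l'" | "l \<le> t" "k \<le> t" "t < l'"
    | "l \<le> t" "t < k" "l' \<le> t" | "l \<le> t" "k \<le> t" "l' \<le> t" by linarith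
  thus ?thesis
  proof cases
    case 1
    hence "visible l k l' x y t = {observe l' t (x t, y t)}"
      using assms by (fastforce simp: visible_def observe_def prod_eq_iff image_iff)
    thus ?thesis using 1 by simp
  next
    case 2
    hence "visible l k l' x y t = Pair (x t) ` {y. (x t, y) \<in> I t}"
      by (force simp: visible_def observe_def)
    thus ?thesis using 2 by (simp add: card_image inj_on_def)
  next
    case 3
    hence "visible l k l' x y t = I t" by (force simp: visible_def observe_def)
    thus ?thesis using 3 by (simp add: numN_def)
  next
    case 4
    hence "visible l k l' x y t = {(x t, 0)}"
      using assms by (force simp: visible_def observe_def)
    thus ?thesis using 4 by simp
  next
    case 5
    hence "visible l k l' x y t = (\<lambda>i. (i, 0)) ` fst ` I t" by (force simp: visible_def observe_def)
    thus ?thesis using 5 by (simp add: card_image inj_on_def numB_def)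
  qed
qed

lemma card_visible_le:
  assumes "(x t, y t) \<in> I t" "l \<le> k" "l \<le> l'"
  shows "card (visible l k l' x y t) \<le> branching l k l' t"
  using card_fiber_le_numC[OF assms(1)] by (simp add: card_visible[of x t y l k l', OF assms] branching_def)

text \<open>The cell indices at levels \<open>k\<close> and \<open>l\<close> leave at most
  \<open>(2 * H + 2)^2\<close> approximate squares for the points of the ball. In each, the observed
  words lie in the product of the \<open>visible\<close> sets, and an observed word determines one
  rectangle of type \<open>(k', l')\<close>.\<close>

lemma efficient_cover:
  fixes R r :: real
  assumes lk: "l \<le> k" "l \<le> l'" "k \<le> k'" "l' \<le> k'"
    and R: "R * radix m k \<le> real H" "R * radix n l \<le> real H" "0 < R"
    and r: "2 \<le> r * radix m k'" "2 \<le> r * radix n l'"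
  shows "\<exists>C. finite C \<and> ball x R \<inter> limit_set \<subseteq> \<Union>C \<and> (\<forall>U\<in>C. bounded U \<and> diameter U \<le> r) \<and>
     card C \<le> (2 * H + 2)^2 * (\<Prod>t<k'. branching l k l' t)"
proof -
  define E where "E = ball x R \<inter> limit_set"
  \<comment> \<open>One word of length \<open>k'\<close> is chosen for each point, so a point on a
    cell boundary is assigned to one cell only. By nesting the word serves all coarser
    levels.\<close>
  have "\<forall>z\<in>E. \<exists>w. (\<forall>t<k'. w t \<in> I t) \<and> fst z \<in> cell m (fst \<circ> w) k' \<and> snd z \<in> cell n (snd \<circ> w) k'"
    by (auto simp: E_def limit_set_def)
  then obtain w where w: "\<And>z t. z \<in> E \<Longrightarrow> t < k' \<Longrightarrow> w z t \<in> I t"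
      "\<And>z. z \<in> E \<Longrightarrow> fst z \<in> cell m (fst \<circ> w z) k'" "\<And>z. z \<in> E \<Longrightarrow> snd z \<in> cell n (snd \<circ> w z) k'"
    by metis
  have wm: "fst z \<in> cell m (fst \<circ> w z) j" and wn: "snd z \<in> cell n (snd \<circ> w z) j"
    if "z \<in> E" "j \<le> k'" for z j
    using that w(2,3)[OF that(1)] cell_antimono[OF that(2), of "fst \<circ> w z" m] cell_antimono[OF that(2), of "snd \<circ> w z" n]
      I_digits[OF w(1)[OF that(1)]] by auto
  define X where "X z = digit_val m (fst \<circ> w z) k" for z
  define Y where "Y z = digit_val n (snd \<circ> w z) l" for z
  \<comment> \<open>\<open>restrict\<close> makes observed words elements of a \<open>PiE\<close>
    product, whose cardinality is a product.\<close>
  define O' where "O' z = restrict (\<lambda>t. observe l' t (w z t)) {..<k'}" for z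
  define rect where "rect v = cell m (fst \<circ> v) k' \<times> cell n (snd \<circ> v) l'" for v
  have dE: "dist z z' \<le> 2 * R" if "z \<in> E" "z' \<in> E" for z z'
  proof -
    have "dist x z < R" "dist x z' < R" using that by (auto simp: E_def)
    thus ?thesis using dist_triangle3[of z z' x] by linarith
  qed
  \<comment> \<open>Two points of the ball are at most \<open>2 * R\<close>, hence
    \<open>2 * H\<close> cell lengths, apart; \<open>digit_val_dist\<close> adds 1.\<close>
  have spreadX: "i \<le> j + (2 * H + 1)" if "i \<in> X ` E" "j \<in> X ` E" for i j
    using that
  proof clarify
    fix z z' assume z: "z \<in> E" "z' \<in> E"
    have "\<bar>fst z - fst z'\<bar> * radix m k \<le> (2 * R) * radix m k"
      using dE[OF z] abs_fst_le_dist[of z z'] by (intro mult_right_mono) auto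
    hence "\<bar>fst z - fst z'\<bar> * radix m k \<le> real (2 * H)" using R by simp
    thus "X z \<le> X z' + (2 * H + 1)"
      unfolding X_def using wm[of z k] wm[of z' k] z lk by (intro digit_val_dist) auto
  qed
  have AX: "finite (X ` E)" "card (X ` E) \<le> 2 * H + 1 + 1"
    by (rule nat_set_bounded_spread[of "X ` E" "2 * H + 1"]; rule spreadX; assumption)+
  have spreadY: "i \<le> j + (2 * H + 1)" if "i \<in> Y ` E" "j \<in> Y ` E" for i j
    using that
  proof clarify
    fix z z' assume z: "z \<in> E" "z' \<in> E"
    have "\<bar>snd z - snd z'\<bar> * radix n l \<le> (2 * R) * radix n l"
      using dE[OF z] abs_snd_le_dist[of z z'] by (intro mult_right_mono) auto
    hence "\<bar>snd z - snd z'\<bar> * radix n l \<le> real (2 * H)" using R by simp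
    thus "Y z \<le> Y z' + (2 * H + 1)"
      unfolding Y_def using wn[of z l] wn[of z' l] z lk by (intro digit_val_dist) auto
  qed
  have AY: "finite (Y ` E)" "card (Y ` E) \<le> 2 * H + 1 + 1"
    by (rule nat_set_bounded_spread[of "Y ` E" "2 * H + 1"]; rule spreadY; assumption)+
  \<comment> \<open>Equal indices force equal digits, so every word in this class agrees with that
    of \<open>z0\<close> in the first \<open>k\<close> columns and the first \<open>l\<close>
    rows.\<close>
  have fib: "finite (O' ` {z\<in>E. X z = i \<and> Y z = j})
      \<and> card (O' ` {z\<in>E. X z = i \<and> Y z = j}) \<le> (\<Prod>t<k'. branching l k l' t)" for i j
  proof (cases "{z\<in>E. X z = i \<and> Y z = j} = {}")
    case False
    then obtain z0 where z0: "z0 \<in> E" "X z0 = i" "Y z0 = j" by blast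
    let ?x = "fst \<circ> w z0" and ?y = "snd \<circ> w z0"
    let ?P = "PiE {..<k'} (visible l k l' ?x ?y)"
    have sub: "O' ` {z\<in>E. X z = i \<and> Y z = j} \<subseteq> ?P"
    proof (clarsimp simp: O'_def visible_def)
      fix z t assume z: "z \<in> E" "t < k'" "i = X z" "j = Y z"
      have "t < k \<longrightarrow> fst (w z t) = fst (w z0 t)"
        using digit_val_inj[of m "fst \<circ> w z" k "fst \<circ> w z0" t] z z0 w(1) lk I_digits
        by (auto simp: X_def)
      moreover have "t < l \<longrightarrow> snd (w z t) = snd (w z0 t)"
        using digit_val_inj[of n "snd \<circ> w z" l "snd \<circ> w z0" t] z z0 w(1) lk I_digits
        by (auto simp: Y_def)
      ultimately show "observe l' t (w z t) \<in> observe l' t ` {j \<in> I t. (t < k \<longrightarrow> fst j = fst (w z0 t)) \<and>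
          (t < l \<longrightarrow> snd j = snd (w z0 t))}"
        using w(1) z by blast
    qed
    have finP: "finite ?P" by (intro finite_PiE) (auto simp: finite_visible)
    have "card ?P \<le> (\<Prod>t<k'. branching l k l' t)"
      by (subst card_PiE, simp, intro prod_mono conjI card_visible_le) (use z0 w(1) lk in auto)
    thus ?thesis using card_mono[OF finP sub] finite_subset[OF sub finP] by linarith
  next
    case True
    show ?thesis unfolding True by simp
  qed
  let ?fib = "\<lambda>q. O' ` {z\<in>E. X z = fst q \<and> Y z = snd q}"
  have O_eq: "O' ` E = (\<Union>q\<in>X ` E \<times> Y ` E. ?fib q)"
  proof (rule equalityI; rule subsetI)
    fix v assume "v \<in> O' ` E"
    then obtain z where "z \<in> E" "v = O' z" by blast
    thus "v \<in> (\<Union>q\<in>X ` E \<times> Y ` E. ?fib q)" by (intro UN_I[of "(X z, Y z)"]) auto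
  qed auto
  have "card (O' ` E) \<le> (\<Sum>q\<in>X ` E \<times> Y ` E. card (?fib q))"
    unfolding O_eq using AX(1) AY(1) by (intro card_UN_le) auto
  also have "\<dots> \<le> (\<Sum>q\<in>X ` E \<times> Y ` E. (\<Prod>t<k'. branching l k l' t))"
    using fib by (intro sum_mono) auto
  also have "\<dots> = card (X ` E) * card (Y ` E) * (\<Prod>t<k'. branching l k l' t)"
    by (simp add: card_cartesian_product)
  also have "\<dots> \<le> (2 * H + 2) * (2 * H + 2) * (\<Prod>t<k'. branching l k l' t)"
    using AX AY by (intro mult_right_mono mult_mono) auto
  finally have cO: "card (O' ` E) \<le> (2 * H + 2)^2 * (\<Prod>t<k'. branching l k l' t)"
    by (simp add: power2_eq_square)
  have fO: "finite (O' ` E)" unfolding O_eq using AX AY fib by auto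
  \<comment> \<open>The zeros that replace unseen rows stand at levels from \<open>l'\<close> on and
    do not affect a row cell of level \<open>l'\<close>.\<close>
  have memO: "z \<in> rect (O' z)" if "z \<in> E" for z
  proof -
    have "cell m (fst \<circ> O' z) k' = cell m (fst \<circ> w z) k'"
      by (rule cell_cong) (simp add: O'_def observe_def)
    moreover have "cell n (snd \<circ> O' z) l' = cell n (snd \<circ> w z) l'"
      by (rule cell_cong) (use lk in \<open>simp add: O'_def observe_def\<close>)
    ultimately show ?thesis using wm[OF that, of k'] wn[OF that, of l'] lk
      by (simp add: rect_def mem_Times_iff)
  qed
  have small: "bounded (rect v) \<and> diameter (rect v) \<le> r" for v
  proof -
    have Mp: "real (radix m k') > 0" "real (radix n l') > 0"
      using radix_pos[of m] radix_pos[of n] m_pos n_pos by auto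
    have rp: "r > 0" using r(1) Mp by (smt (verit) mult_nonneg_nonneg zero_less_mult_iff)
    have d: "dist z z' \<le> r" if "z \<in> rect v" "z' \<in> rect v" for z z'
    proof -
      have "\<bar>fst z - fst z'\<bar> * radix m k' \<le> (r / 2) * radix m k'"
           "\<bar>snd z - snd z'\<bar> * radix n l' \<le> (r / 2) * radix n l'"
        using r cell_dist[of "fst z" m "fst \<circ> v" k' "fst z'"] cell_dist[of "snd z" n "snd \<circ> v" l' "snd z'"] that
        by (auto simp: rect_def mem_Times_iff)
      hence "\<bar>fst z - fst z'\<bar> \<le> r / 2" "\<bar>snd z - snd z'\<bar> \<le> r / 2"
        using Mp by (auto dest: mult_right_le_imp_le)
      thus ?thesis using dist_prod_le[of z z'] by linarith
    qed
    have "bounded (rect v)"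
    proof (cases "rect v = {}")
      case False
      then obtain z where "z \<in> rect v" by blast
      thus ?thesis unfolding bounded_def using d by blast
    qed simp
    moreover have "diameter (rect v) \<le> r"
      using d rp by (intro diameter_le) (auto simp: dist_norm)
    ultimately show ?thesis ..
  qed
  show ?thesis
  proof (intro exI[of _ "rect ` O' ` E"] conjI)
    show "card (rect ` O' ` E) \<le> (2 * H + 2)^2 * (\<Prod>t<k'. branching l k l' t)"
      using card_image_le[OF fO, of rect] cO by linarith
    show "ball x R \<inter> limit_set \<subseteq> \<Union> (rect ` O' ` E)" using memO by (auto simp: E_def[symmetric])
  qed (use fO small in auto)
qed

text \<open>Prescribing the fullest column at each level makes the \<open>visible\<close> sets as
  large as \<open>branching\<close> allows. The resulting points lie in one ball of radius
  \<open>R\<close>, while a set of diameter at most \<open>r\<close> captures at most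
  \<open>(H + 2)^2\<close> of the words.\<close>

lemma every_cover_large:
  fixes R r :: real
  assumes lk: "l \<le> k" "l \<le> l'" "k \<le> k'" "l' \<le> k'"
    and R: "3 \<le> R * radix m k" "3 \<le> R * radix n l"
    and r: "r * radix m k' \<le> real H" "r * radix n l' \<le> real H"
  shows "\<exists>x\<in>limit_set. \<forall>C. finite C \<and> ball x R \<inter> limit_set \<subseteq> \<Union>C \<and> (\<forall>U\<in>C. bounded U \<and> diameter U \<le> r) \<longrightarrow>
     (\<Prod>t<k'. branching l k l' t) \<le> (H + 2)^2 * card C"
proof -
  obtain x y where xy: "\<And>t. (x t, y t) \<in> I t" "\<And>t. card {y. (x t, y) \<in> I t} = numC (I t)"
    using numC_attained by metis
  define P where "P = PiE {..<k'} (visible l k l' x y)"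
  have finP: "finite P" unfolding P_def by (intro finite_PiE) (auto simp: finite_visible)
  have cardP: "card P = (\<Prod>t<k'. branching l k l' t)"
    unfolding P_def by (subst card_PiE, simp, intro prod.cong refl)
      (simp add: card_visible[of x _ y] xy lk branching_def)
  \<comment> \<open>An observed word lifts to an infinite word that keeps the prescribed digits; its
    letters from level \<open>k'\<close> on are arbitrary.\<close>
  have "\<exists>w. (\<forall>t. w t \<in> I t) \<and> (\<forall>t<k'. v t = observe l' t (w t)) \<and>
      (\<forall>t<k. fst (w t) = x t) \<and> (\<forall>t<l. snd (w t) = y t)" if "v \<in> P" for v
  proof -
    have "\<exists>j. j \<in> I t \<and> (t < k' \<longrightarrow> v t = observe l' t j \<and> (t < k \<longrightarrow> fst j = x t) \<and> (t < l \<longrightarrow> snd j = y t))" for t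
    proof (cases "t < k'")
      case True
      hence "v t \<in> visible l k l' x y t" using that by (auto simp: P_def)
      then obtain j where "v t = observe l' t j" "j \<in> I t" "t < k \<longrightarrow> fst j = x t" "t < l \<longrightarrow> snd j = y t"
        unfolding visible_def by blast
      thus ?thesis by blast
    next
      case False thus ?thesis using xy(1)[of t] by auto
    qed
    then obtain w where "\<And>t. w t \<in> I t \<and> (t < k' \<longrightarrow> v t = observe l' t (w t) \<and> (t < k \<longrightarrow> fst (w t) = x t) \<and> (t < l \<longrightarrow> snd (w t) = y t))"
      by metis
    thus ?thesis using lk by (intro exI[of _ w]) auto
  qed
  then obtain w where w: "\<And>v t. v \<in> P \<Longrightarrow> w v t \<in> I t" "\<And>v t. v \<in> P \<Longrightarrow> t < k' \<Longrightarrow> v t = observe l' t (w v t)"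
      "\<And>v t. v \<in> P \<Longrightarrow> t < k \<Longrightarrow> fst (w v t) = x t" "\<And>v t. v \<in> P \<Longrightarrow> t < l \<Longrightarrow> snd (w v t) = y t"
    by metis
  have "\<forall>v\<in>P. \<exists>z\<in>limit_set. \<forall>j. fst z \<in> cell m (fst \<circ> w v) j \<and> snd z \<in> cell n (snd \<circ> w v) j"
    using word_in_limit_set w(1) by blast
  then obtain z where z: "\<And>v. v \<in> P \<Longrightarrow> z v \<in> limit_set"
      "\<And>v j. v \<in> P \<Longrightarrow> fst (z v) \<in> cell m (fst \<circ> w v) j" "\<And>v j. v \<in> P \<Longrightarrow> snd (z v) \<in> cell n (snd \<circ> w v) j"
    by metis
  have Mp: "real (radix m k) > 0" "real (radix n l) > 0"
    using radix_pos[of m] radix_pos[of n] m_pos n_pos by auto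
  have Rp: "R > 0" using R(1) Mp by (smt (verit) mult_nonneg_nonneg zero_less_mult_iff)
  \<comment> \<open>Sharing \<open>k\<close> columns and \<open>l\<close> rows leaves at most
    \<open>R / 3\<close> per coordinate, hence a distance of at most \<open>2 * R / 3\<close>,
    strictly inside the open ball.\<close>
  have close: "dist (z v) (z v') < R" if v: "v \<in> P" "v' \<in> P" for v v'
  proof -
    have "cell m (fst \<circ> w v) k = cell m (fst \<circ> w v') k" "cell n (snd \<circ> w v) l = cell n (snd \<circ> w v') l"
      using w v by (auto intro!: cell_cong)
    hence "\<bar>fst (z v) - fst (z v')\<bar> * radix m k \<le> 1" "\<bar>snd (z v) - snd (z v')\<bar> * radix n l \<le> 1"
      using z(2)[OF v(1), of k] z(2)[OF v(2), of k] z(3)[OF v(1), of l] z(3)[OF v(2), of l] by (auto intro: cell_dist)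
    hence "\<bar>fst (z v) - fst (z v')\<bar> * radix m k \<le> (R / 3) * radix m k"
        "\<bar>snd (z v) - snd (z v')\<bar> * radix n l \<le> (R / 3) * radix n l" using R by auto
    hence "\<bar>fst (z v) - fst (z v')\<bar> \<le> R / 3" "\<bar>snd (z v) - snd (z v')\<bar> \<le> R / 3"
      using Mp by (auto dest: mult_right_le_imp_le)
    thus ?thesis using dist_prod_le[of "z v" "z v'"] Rp by linarith
  qed
  have "visible l k l' x y t \<noteq> {}" for t using xy(1)[of t] by (auto simp: visible_def)
  hence "P \<noteq> {}" by (simp add: P_def PiE_eq_empty_iff)
  then obtain v0 where v0: "v0 \<in> P" by blast
  define X where "X v = digit_val m (fst \<circ> w v) k'" for v
  define Y where "Y v = digit_val n (snd \<circ> w v) l'" for v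
  \<comment> \<open>The indices at levels \<open>k'\<close> and \<open>l'\<close> recover exactly
    what \<open>observe\<close> records. Words rather than points are counted, since distinct words
    may yield the same point.\<close>
  have inj: "inj_on (\<lambda>v. (X v, Y v)) P"
  proof (rule inj_onI)
    fix v v' assume v: "v \<in> P" "v' \<in> P" and eq: "(X v, Y v) = (X v', Y v')"
    have "v t = v' t" if t: "t < k'" for t
    proof -
      have "fst (w v t) = fst (w v' t)"
        using digit_val_inj[of m "fst \<circ> w v" k' "fst \<circ> w v'" t] t v eq w(1) I_digits by (auto simp: X_def)
      moreover have "snd (w v t) = snd (w v' t)" if "t < l'"
        using digit_val_inj[of n "snd \<circ> w v" l' "snd \<circ> w v'" t] that v eq w(1) I_digits by (auto simp: Y_def)
      ultimately show ?thesis using w(2)[OF v(1) t] w(2)[OF v(2) t] by (simp add: observe_def)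
    qed
    thus "v = v'" using v unfolding P_def by (intro PiE_ext) auto
  qed
  have fib: "card {v\<in>P. z v \<in> U} \<le> (H + 2)^2" if U: "bounded U" "diameter U \<le> r" for U
  proof -
    let ?V = "{v\<in>P. z v \<in> U}"
    have dU: "dist (z v) (z v') \<le> r" if "v \<in> ?V" "v' \<in> ?V" for v v'
      using diameter_bounded_bound[OF U(1), of "z v" "z v'"] U(2) that by auto
    have spreadX: "i \<le> j + (H + 1)" if "i \<in> X ` ?V" "j \<in> X ` ?V" for i j
      using that
    proof (elim imageE; hypsubst)
      fix v v' assume v: "v \<in> ?V" "v' \<in> ?V"
      have "\<bar>fst (z v) - fst (z v')\<bar> * radix m k' \<le> r * radix m k'"
        using dU[OF v] abs_fst_le_dist[of "z v" "z v'"] by (intro mult_right_mono) auto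
      hence "\<bar>fst (z v) - fst (z v')\<bar> * radix m k' \<le> real H" using r by simp
      thus "X v \<le> X v' + (H + 1)"
        unfolding X_def using z(2)[of v k'] z(2)[of v' k'] v by (intro digit_val_dist) auto
    qed
    have AX: "finite (X ` ?V)" "card (X ` ?V) \<le> H + 1 + 1"
    by (rule nat_set_bounded_spread[of "X ` ?V" "H + 1"]; rule spreadX; assumption)+
    have spreadY: "i \<le> j + (H + 1)" if "i \<in> Y ` ?V" "j \<in> Y ` ?V" for i j
      using that
    proof (elim imageE; hypsubst)
      fix v v' assume v: "v \<in> ?V" "v' \<in> ?V"
      have "\<bar>snd (z v) - snd (z v')\<bar> * radix n l' \<le> r * radix n l'"
        using dU[OF v] abs_snd_le_dist[of "z v" "z v'"] by (intro mult_right_mono) auto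
      hence "\<bar>snd (z v) - snd (z v')\<bar> * radix n l' \<le> real H" using r by simp
      thus "Y v \<le> Y v' + (H + 1)"
        unfolding Y_def using z(3)[of v l'] z(3)[of v' l'] v by (intro digit_val_dist) auto
    qed
    have AY: "finite (Y ` ?V)" "card (Y ` ?V) \<le> H + 1 + 1"
    by (rule nat_set_bounded_spread[of "Y ` ?V" "H + 1"]; rule spreadY; assumption)+
    have "card ?V = card ((\<lambda>v. (X v, Y v)) ` ?V)"
      by (rule card_image[symmetric], rule inj_on_subset[OF inj]) auto
    also have "\<dots> \<le> card (X ` ?V \<times> Y ` ?V)" using AX AY by (intro card_mono) auto
    also have "\<dots> \<le> (H + 2) * (H + 2)" unfolding card_cartesian_product using AX AY by (intro mult_mono) auto
    finally show ?thesis by (simp add: power2_eq_square)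
  qed
  show ?thesis
  \<comment> \<open>The points are pairwise closer than \<open>R\<close>, so any of them can be the
    centre.\<close>
  proof (intro bexI[of _ "z v0"] allI impI, elim conjE)
    fix C assume C: "finite C" "ball (z v0) R \<inter> limit_set \<subseteq> \<Union>C" "\<forall>U\<in>C. bounded U \<and> diameter U \<le> r"
    have "P \<subseteq> (\<Union>U\<in>C. {v\<in>P. z v \<in> U})"
    proof
      fix v assume v: "v \<in> P"
      hence "z v \<in> ball (z v0) R \<inter> limit_set" using close[OF v0 v] z(1) by auto
      thus "v \<in> (\<Union>U\<in>C. {v\<in>P. z v \<in> U})" using C(2) v by blast
    qed
    hence "card P \<le> card (\<Union>U\<in>C. {v\<in>P. z v \<in> U})" using C(1) finP by (intro card_mono) auto
    also have "\<dots> \<le> (\<Sum>U\<in>C. card {v\<in>P. z v \<in> U})" by (rule card_UN_le[OF C(1)])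
    also have "\<dots> \<le> (\<Sum>U\<in>C. (H + 2)^2)" using C(3) fib by (intro sum_mono) auto
    finally show "(\<Prod>t<k'. branching l k l' t) \<le> (H + 2)^2 * card C" by (simp add: cardP mult.commute)
  qed (use z v0 in auto)
qed

end

section \<open>Asymptotics of the counts\<close>

text \<open>Scales enter through their reciprocals: for \<open>s = 1 / R\<close> this is the first
  level whose cells have length at most \<open>R\<close>.\<close>

definition level :: "(nat \<Rightarrow> nat) \<Rightarrow> real \<Rightarrow> nat" where
  "level q s = (LEAST k. s \<le> real (radix q k))"

lemma level_le: "s \<le> real (radix q k) \<Longrightarrow> level q s \<le> k"
  unfolding level_def by (rule Least_le)

lemma radix_ge_power2: "(\<And>t. 2 \<le> q t) \<Longrightarrow> 2 ^ k \<le> radix q k"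
  by (induction k) (auto simp: mult.commute intro!: mult_mono)

lemma le_radix_level:
  assumes "\<And>t. 2 \<le> q t" shows "s \<le> real (radix q (level q s))"
  unfolding level_def
proof (rule LeastI_ex)
  obtain k where "s < 2 ^ k" using real_arch_pow[of 2 s] by auto
  moreover have "2 ^ k \<le> real (radix q k)"
    using radix_ge_power2[of q k, OF assms] by (metis of_nat_le_iff of_nat_numeral of_nat_power)
  ultimately show "\<exists>k. s \<le> real (radix q k)" by (intro exI[of _ k]) linarith
qed

text \<open>By minimality the product one level earlier is below \<open>s\<close>, and the last
  factor is at most \<open>b\<close>. At level 0 the product is 1, which is where
  \<open>1 \<le> s\<close> enters.\<close>

lemma radix_level_le:
  fixes b :: nat and s :: real
  assumes "\<And>t. 2 \<le> q t" "\<And>t. q t \<le> b" "1 \<le> s"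
  shows "real (radix q (level q s)) \<le> b * s"
proof (cases "level q s")
  case 0
  have "1 \<le> b" using assms(1,2)[of 0] by linarith
  hence "1 * 1 \<le> real b * s" using assms(3) by (intro mult_mono) auto
  thus ?thesis using 0 by simp
next
  case (Suc j)
  have "\<not> s \<le> real (radix q j)" using level_le[of s q j] Suc by auto
  hence "real (radix q j) * real (q j) \<le> s * real b"
    using assms by (intro mult_mono) auto
  thus ?thesis using Suc by (simp add: mult.commute)
qed

lemma level_mono:
  assumes "\<And>t. 2 \<le> q t" "s \<le> s'" shows "level q s \<le> level q s'"
  using le_radix_level[of q s', OF assms(1)] assms(2) by (intro level_le) linarith

lemma radix_mono: "(\<And>t. 0 < q t) \<Longrightarrow> j \<le> k \<Longrightarrow> radix q j \<le> radix q k"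
  unfolding radix_def by (rule dvd_imp_le[OF prod_dvd_prod_subset]) (auto simp: prod_pos)

lemma ln_radix:
  assumes "\<And>t. 0 < q t" shows "ln (real (radix q k)) = (\<Sum>t<k. ln (real (q t)))"
  unfolding radix_def of_nat_prod using assms by (intro ln_prod) auto

lemma level_at_top:
  assumes "\<And>t. 2 \<le> q t" shows "filterlim (level q) at_top at_top"
  unfolding filterlim_at_top
proof
  fix Z
  have q: "0 < q t" for t using assms[of t] by simp
  show "eventually (\<lambda>s. Z \<le> level q s) at_top"
    using eventually_gt_at_top[of "real (radix q Z)"]
  proof eventually_elim
    case (elim s)
    show ?case
    proof (rule ccontr)
      assume "\<not> Z \<le> level q s"
      hence "real (radix q (level q s)) \<le> real (radix q Z)"
        using radix_mono[of q "level q s" Z, OF q] by simp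
      thus False using elim le_radix_level[of q s, OF assms] by linarith
    qed
  qed
qed

text \<open>\<open>radix q (level q s)\<close> lies between \<open>s\<close> and
  \<open>b * s\<close>, so its logarithm is asymptotic to \<open>ln s\<close>; by the averages it is
  also asymptotic to \<mu> times the level.\<close>

lemma level_asymp:
  fixes b :: nat
  assumes q: "\<And>t. 2 \<le> q t" "\<And>t. q t \<le> b"
    and avg: "(\<lambda>k. (\<Sum>t<k. ln (real (q t))) / real k) \<longlonglongrightarrow> \<mu>" and pos: "\<mu> > 0"
  shows "((\<lambda>s. real (level q s) / ln s) \<longlongrightarrow> 1 / \<mu>) at_top"
proof -
  have q0: "0 < q t" for t using q(1)[of t] by simp
  let ?L = "\<lambda>s. ln (real (radix q (level q s)))"
  have 1: "((\<lambda>s. ?L s / real (level q s)) \<longlongrightarrow> \<mu>) at_top"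
    using filterlim_compose[OF avg level_at_top[of q, OF q(1)]] by (simp add: ln_radix[of q, OF q0])
  have 2: "((\<lambda>s. ?L s / ln s) \<longlongrightarrow> 1) at_top"
  proof (rule tendsto_sandwich)
    show "eventually (\<lambda>s. 1 \<le> ?L s / ln s) at_top"
      using eventually_gt_at_top[of 1]
    proof eventually_elim
      case (elim s)
      have "ln s \<le> ?L s" using le_radix_level[of q s, OF q(1)] elim by (intro ln_mono) auto
      thus ?case using elim by simp
    qed
    show "eventually (\<lambda>s. ?L s / ln s \<le> (ln b + ln s) / ln s) at_top"
      using eventually_gt_at_top[of 1]
    proof eventually_elim
      case (elim s)
      have "0 < real (radix q (level q s))" using radix_pos[of q, OF q0] by simp
      moreover have "0 < b" using q[of 0] by simp
      ultimately have "?L s \<le> ln (b * s)"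
        using radix_level_le[of q b s, OF q] elim by (subst ln_le_cancel_iff) auto
      also have "\<dots> = ln b + ln s" using elim \<open>0 < b\<close> by (simp add: ln_mult)
      finally show ?case using elim by (simp add: divide_right_mono)
    qed
    show "((\<lambda>s. (ln b + ln s) / ln s) \<longlongrightarrow> 1) at_top" by real_asymp
  qed simp
  have "((\<lambda>s. (?L s / ln s) / (?L s / real (level q s))) \<longlongrightarrow> 1 / \<mu>) at_top"
    by (intro tendsto_divide 1 2) (use pos in auto)
  moreover have "eventually (\<lambda>s. (?L s / ln s) / (?L s / real (level q s)) = real (level q s) / ln s) at_top"
    using eventually_gt_at_top[of 1]
  proof eventually_elim
    case (elim s)
    have "ln s \<le> ?L s" using le_radix_level[of q s, OF q(1)] elim by (intro ln_mono) auto
    moreover have "ln s > 0" using elim by simp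
    ultimately show ?case by simp
  qed
  ultimately show ?thesis by (rule Lim_transform_eventually)
qed

text \<open>The factor \<beta> only adds a constant to the logarithm, so constants lost in covering
  estimates vanish in the limit.\<close>

lemma level_power_asymp:
  fixes b :: nat
  assumes q: "\<And>t. 2 \<le> q t" "\<And>t. q t \<le> b"
    and avg: "(\<lambda>k. (\<Sum>t<k. ln (real (q t))) / real k) \<longlonglongrightarrow> \<mu>" and pos: "\<mu> > 0"
    and a: "a > 0" "\<beta> > 0"
  shows "((\<lambda>s. real (level q (\<beta> * s powr a)) / ln s) \<longlongrightarrow> a / \<mu>) at_top"
proof -
  have top: "filterlim (\<lambda>s. \<beta> * s powr a) at_top at_top" using a by real_asymp
  have "((\<lambda>s. ln (\<beta> * s powr a) / ln s) \<longlongrightarrow> a) at_top"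
  proof (rule Lim_transform_eventually)
    show "((\<lambda>s. ln \<beta> / ln s + a) \<longlongrightarrow> a) at_top" by real_asymp
    show "eventually (\<lambda>s. ln \<beta> / ln s + a = ln (\<beta> * s powr a) / ln s) at_top"
      using eventually_gt_at_top[of 1]
      by eventually_elim (use a in \<open>simp add: ln_mult ln_powr add_divide_distrib\<close>)
  qed
  from tendsto_mult[OF filterlim_compose[OF level_asymp[of q b, OF q avg pos] top] this]
  have "((\<lambda>s. real (level q (\<beta> * s powr a)) / ln (\<beta> * s powr a) * (ln (\<beta> * s powr a) / ln s))
      \<longlongrightarrow> a / \<mu>) at_top" by simp
  moreover have "eventually (\<lambda>s. real (level q (\<beta> * s powr a)) / ln (\<beta> * s powr a) * (ln (\<beta> * s powr a) / ln s)
      = real (level q (\<beta> * s powr a)) / ln s) at_top"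
    using filterlim_at_top_dense[THEN iffD1, OF top, rule_format, of 1]
    by eventually_elim auto
  ultimately show ?thesis by (rule Lim_transform_eventually)
qed

lemma sum_along_asymp:
  fixes f :: "nat \<Rightarrow> real"
  assumes avg: "(\<lambda>k. (\<Sum>t<k. f t) / real k) \<longlonglongrightarrow> \<gamma>"
    and j: "((\<lambda>s. real (j s) / ln s) \<longlongrightarrow> \<kappa>) at_top" and pos: "\<kappa> > 0"
  shows "((\<lambda>s. (\<Sum>t<j s. f t) / ln s) \<longlongrightarrow> \<gamma> * \<kappa>) at_top"
proof -
  \<comment> \<open>A positive limit of \<open>j s / ln s\<close> forces \<open>j s\<close> to
    infinity, so the averages may be taken along \<open>j s\<close>.\<close>
  have "filterlim (\<lambda>s::real. real (j s) / ln s * ln s) at_top at_top"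
    by (rule filterlim_tendsto_pos_mult_at_top[OF j pos]) real_asymp
  hence "filterlim (\<lambda>s. real (j s)) at_top at_top"
    by (rule filterlim_mono_eventually) (auto intro: eventually_mono[OF eventually_gt_at_top[of 1]])
  hence "filterlim j at_top at_top"
    by (simp add: filterlim_sequentially_iff_filterlim_real)
  from tendsto_mult[OF filterlim_compose[OF avg this] j]
  have "((\<lambda>s. (\<Sum>t<j s. f t) / real (j s) * (real (j s) / ln s)) \<longlongrightarrow> \<gamma> * \<kappa>) at_top" .
  moreover have "(\<Sum>t<j s. f t) / real (j s) * (real (j s) / ln s) = (\<Sum>t<j s. f t) / ln s" for s
    by (cases "j s = 0") auto
  ultimately show ?thesis by (simp only:)
qed

section \<open>Covering numbers of balls in the limit set\<close>

lemma cover_number_le: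
  assumes "finite C" "E \<subseteq> \<Union>C" "\<And>U. U \<in> C \<Longrightarrow> bounded U \<and> diameter U \<le> r"
  shows "cover_number E r \<le> card C"
  unfolding cover_number_def by (rule Least_le) (use assms in blast)

text \<open>One admissible finite cover ensures that the \<open>LEAST\<close> is a genuine minimum
  and not an arbitrary value.\<close>

lemma cover_number_attained:
  assumes "finite C" "E \<subseteq> \<Union>C" "\<And>U. U \<in> C \<Longrightarrow> bounded U \<and> diameter U \<le> r"
  shows "\<exists>C. finite C \<and> card C = cover_number E r \<and> E \<subseteq> \<Union>C \<and> (\<forall>U\<in>C. bounded U \<and> diameter U \<le> r)"
  unfolding cover_number_def
  by (rule LeastI_ex[where P = "\<lambda>k. \<exists>C. finite C \<and> card C = k \<and> E \<subseteq> \<Union>C \<and> (\<forall>U\<in>C. bounded U \<and> diameter U \<le> r)"])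
     (use assms in blast)

context grid_sequence
begin

lemma numC_pos: "1 \<le> numC (I t)"
proof -
  obtain x y where xy: "(x, y) \<in> I t" "card {y. (x, y) \<in> I t} = numC (I t)" using numC_attained by blast
  have "0 < card {y. (x, y) \<in> I t}"
    using finite_fiber[of x t] xy(1) by (subst card_gt_0_iff) auto
  thus ?thesis using xy(2) by linarith
qed

lemma numB_pos: "1 \<le> numB (I t)"
  using I_ne[of t] finite_I[of t] by (simp add: numB_def Suc_le_eq card_gt_0_iff)

lemma numN_pos: "1 \<le> numN (I t)"
  using I_ne[of t] finite_I[of t] by (simp add: numN_def Suc_le_eq card_gt_0_iff)

lemma branching_pos: "1 \<le> branching l k l' t"
  using numC_pos numB_pos numN_pos by (simp add: branching_def)

lemma numC_le_numN: "numC (I t) \<le> numN (I t)"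
proof -
  obtain x y where xy: "(x, y) \<in> I t" "card {y. (x, y) \<in> I t} = numC (I t)" using numC_attained by blast
  have "card (Pair x ` {y. (x, y) \<in> I t}) \<le> card (I t)" by (rule card_mono[OF finite_I]) auto
  thus ?thesis using xy by (simp add: card_image inj_on_def numN_def)
qed

lemma numB_le_numN: "numB (I t) \<le> numN (I t)"
  unfolding numB_def numN_def by (rule card_image_le[OF finite_I])

lemma numN_le: "numN (I t) \<le> b * b"
proof -
  have "numN (I t) \<le> card ({..<m t} \<times> {..<n t})"
    unfolding numN_def by (rule card_mono[OF _ I_sub]) simp
  also have "\<dots> \<le> b * b" using m_less_n[of t] n_le[of t] by (simp add: mult_mono)
  finally show ?thesis .
qed

lemma branching_le: "branching l k l' t \<le> b * b"
  using numC_le_numN[of t] numB_le_numN[of t] numN_le[of t] numN_pos[of t] n_le[of t] n_pos[of t]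
  by (auto simp: branching_def Suc_le_eq)

definition log_count :: "nat \<Rightarrow> nat \<Rightarrow> nat \<Rightarrow> nat \<Rightarrow> real" where
  "log_count l k l' k' = (\<Sum>t<k'. ln (real (branching l k l' t)))"

lemma log_count_nonneg: "0 \<le> log_count l k l' k'"
  unfolding log_count_def using branching_pos by (intro sum_nonneg ln_ge_zero) (simp add: real_of_nat_ge_one_iff)

lemma exp_log_count: "exp (log_count l k l' k') = real (\<Prod>t<k'. branching l k l' t)"
  unfolding log_count_def exp_sum[OF finite_lessThan] of_nat_prod
  using branching_pos by (intro prod.cong refl exp_ln) (simp add: Suc_le_eq)

text \<open>With \<open>u = min k l'\<close> and \<open>v = max k l'\<close>, levels in
  \<open>{l..<u}\<close> contribute \<open>numC\<close>, those in \<open>{u..<l'}\<close>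
  \<open>numN\<close>, those in \<open>{v..<k'}\<close> \<open>numB\<close>, and all others the
  factor 1. This treats both orders of \<open>k\<close> and \<open>l'\<close> at once. Partial sums
  from 0 appear because the averages control their growth.\<close>

lemma log_count_eq:
  assumes "l \<le> k" "l \<le> l'" "k \<le> k'" "l' \<le> k'"
  shows "log_count l k l' k' =
    ((\<Sum>t<min k l'. ln (numC (I t))) - (\<Sum>t<l. ln (numC (I t))))
    + ((\<Sum>t<l'. ln (numN (I t))) - (\<Sum>t<min k l'. ln (numN (I t))))
    + ((\<Sum>t<k'. ln (numB (I t))) - (\<Sum>t<max k l'. ln (numB (I t))))"
proof -
  define u v where "u = min k l'" "v = max k l'"
  note uv = u_v_def
  let ?f = "\<lambda>t. ln (real (branching l k l' t))"
  have diff: "(\<Sum>t<j. g t) - (\<Sum>t<i. g t) = (\<Sum>t=i..<j. g t)" if "i \<le> j" for i j and g :: "nat \<Rightarrow> real"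
    using that sum_diff_nat_ivl[of 0 i j g] by (simp add: atLeast0LessThan)
  have le: "l \<le> u" "u \<le> l'" "l' \<le> v" "v \<le> k'" using assms by (auto simp: uv)
  have "log_count l k l' k' = (\<Sum>t=0..<l. ?f t) + (\<Sum>t=l..<u. ?f t) + (\<Sum>t=u..<l'. ?f t)
      + (\<Sum>t=l'..<v. ?f t) + (\<Sum>t=v..<k'. ?f t)"
    unfolding log_count_def atLeast0LessThan[symmetric] using le
    by (simp add: sum.atLeastLessThan_concat)
  moreover have "(\<Sum>t=0..<l. ?f t) = 0" by (rule sum.neutral) (simp add: branching_def)
  moreover have "(\<Sum>t=l'..<v. ?f t) = 0"
    by (rule sum.neutral) (use assms in \<open>auto simp: branching_def uv\<close>)
  moreover have "(\<Sum>t=l..<u. ?f t) = (\<Sum>t=l..<u. ln (numC (I t)))"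
    by (rule sum.cong) (auto simp: branching_def uv)
  moreover have "(\<Sum>t=u..<l'. ?f t) = (\<Sum>t=u..<l'. ln (numN (I t)))"
    by (rule sum.cong) (use assms in \<open>auto simp: branching_def uv\<close>)
  moreover have "(\<Sum>t=v..<k'. ?f t) = (\<Sum>t=v..<k'. ln (numB (I t)))"
    by (rule sum.cong) (use assms in \<open>auto simp: branching_def uv\<close>)
  ultimately show ?thesis using le by (simp add: diff uv)
qed

lemma m_le: "m t \<le> b" and n_ge: "2 \<le> n t"
  using m_less_n[of t] n_le[of t] m_ge[of t] by auto

text \<open>Products of the larger bases \<open>n\<close> reach \<open>s\<close> no later than those
  of \<open>m\<close>.\<close>

lemma level_n_le_level_m: "level n s \<le> level m s"
proof (rule level_le)
  have "radix m (level m s) \<le> radix n (level m s)"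
    unfolding radix_def by (intro prod_mono) (auto intro: less_imp_le[OF m_less_n])
  thus "s \<le> real (radix n (level m s))"
    using le_radix_level[of m s, OF m_ge] by (meson of_nat_le_iff order_trans)
qed

lemma levels_ordered:
  assumes "s \<le> s'"
  shows "level n s \<le> level m s" "level n s \<le> level n s'" "level m s \<le> level m s'" "level n s' \<le> level m s'"
  using assms by (auto intro: level_n_le_level_m level_mono m_ge n_ge)

text \<open>Both arguments are reciprocal side lengths: \<open>s\<close> belongs to the given
  square, \<open>s'\<close> to the subsquares counted in it.\<close>

definition scale_count :: "real \<Rightarrow> real \<Rightarrow> real" where
  "scale_count s s' = log_count (level n s) (level m s) (level n s') (level m s')"

text \<open>Divided by \<open>ln s\<close>, the levels \<open>l\<close>, \<open>k\<close>,
  \<open>l'\<close>, \<open>k'\<close> tend to \<open>1 / \<mu>n\<close>, \<open>1 / \<mu>m\<close>,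
  \<open>a / \<mu>n\<close>, \<open>a / \<mu>m\<close>; \<open>log_count_eq\<close> then gives the
  limit.\<close>

lemma scale_count_asymp:
  assumes avg: "(\<lambda>k. (\<Sum>t<k. ln (real (m t))) / real k) \<longlonglongrightarrow> \<mu>m"
      "(\<lambda>k. (\<Sum>t<k. ln (real (n t))) / real k) \<longlonglongrightarrow> \<mu>n"
      "(\<lambda>k. (\<Sum>t<k. ln (real (numB (I t)))) / real k) \<longlonglongrightarrow> \<gamma>B"
      "(\<lambda>k. (\<Sum>t<k. ln (real (numC (I t)))) / real k) \<longlonglongrightarrow> \<gamma>C"
      "(\<lambda>k. (\<Sum>t<k. ln (real (numN (I t)))) / real k) \<longlonglongrightarrow> \<gamma>N"
    and pos: "\<mu>m > 0" "\<mu>n > 0" and a: "a > 1" and \<beta>: "\<beta> > 0" "\<beta>' > 0"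
  shows "((\<lambda>s. scale_count (\<beta> * s) (\<beta>' * s powr a) / ln s) \<longlongrightarrow>
     (\<gamma>C * min (1 / \<mu>m) (a / \<mu>n) - \<gamma>C * (1 / \<mu>n)) + (\<gamma>N * (a / \<mu>n) - \<gamma>N * min (1 / \<mu>m) (a / \<mu>n))
     + (\<gamma>B * (a / \<mu>m) - \<gamma>B * max (1 / \<mu>m) (a / \<mu>n))) at_top"
proof -
  \<comment> \<open>Writing \<open>s powr 1\<close> makes the coarse levels instances of
    \<open>level_power_asymp\<close> as well.\<close>
  let ?l = "\<lambda>s. level n (\<beta> * s powr 1)" and ?k = "\<lambda>s. level m (\<beta> * s powr 1)"
  let ?l' = "\<lambda>s. level n (\<beta>' * s powr a)" and ?k' = "\<lambda>s. level m (\<beta>' * s powr a)"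
  have l: "((\<lambda>s. real (?l s) / ln s) \<longlongrightarrow> 1 / \<mu>n) at_top" "((\<lambda>s. real (?l' s) / ln s) \<longlongrightarrow> a / \<mu>n) at_top"
    using a \<beta> pos by (intro level_power_asymp[of n b] n_ge n_le avg; simp)+
  have k: "((\<lambda>s. real (?k s) / ln s) \<longlongrightarrow> 1 / \<mu>m) at_top" "((\<lambda>s. real (?k' s) / ln s) \<longlongrightarrow> a / \<mu>m) at_top"
    using a \<beta> pos by (intro level_power_asymp[of m b] m_ge m_le avg; simp)+
  have u: "((\<lambda>s. real (min (?k s) (?l' s)) / ln s) \<longlongrightarrow> min (1 / \<mu>m) (a / \<mu>n)) at_top"
    by (rule Lim_transform_eventually[OF tendsto_min[OF k(1) l(2)]], rule eventually_mono[OF eventually_gt_at_top[of 1]])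
       (auto simp: min_def divide_le_cancel)
  have v: "((\<lambda>s. real (max (?k s) (?l' s)) / ln s) \<longlongrightarrow> max (1 / \<mu>m) (a / \<mu>n)) at_top"
    by (rule Lim_transform_eventually[OF tendsto_max[OF k(1) l(2)]], rule eventually_mono[OF eventually_gt_at_top[of 1]])
       (auto simp: max_def divide_le_cancel)
  have lim: "((\<lambda>s. ((\<Sum>t<min (?k s) (?l' s). ln (numC (I t))) / ln s - (\<Sum>t<?l s. ln (numC (I t))) / ln s)
    + ((\<Sum>t<?l' s. ln (numN (I t))) / ln s - (\<Sum>t<min (?k s) (?l' s). ln (numN (I t))) / ln s)
    + ((\<Sum>t<?k' s. ln (numB (I t))) / ln s - (\<Sum>t<max (?k s) (?l' s). ln (numB (I t))) / ln s)) \<longlongrightarrow>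
     (\<gamma>C * min (1 / \<mu>m) (a / \<mu>n) - \<gamma>C * (1 / \<mu>n)) + (\<gamma>N * (a / \<mu>n) - \<gamma>N * min (1 / \<mu>m) (a / \<mu>n))
     + (\<gamma>B * (a / \<mu>m) - \<gamma>B * max (1 / \<mu>m) (a / \<mu>n))) at_top"
    using a pos
    by (intro tendsto_add tendsto_diff sum_along_asymp avg l k u v) (auto simp: less_max_iff_disj)
  \<comment> \<open>\<open>a > 1\<close> eventually puts the scales in the order that
    \<open>log_count_eq\<close> requires, whatever the constants.\<close>
  have "eventually (\<lambda>s. \<beta> * s \<le> \<beta>' * s powr a) at_top"
    using a \<beta> by real_asymp
  hence "eventually (\<lambda>s. ((\<Sum>t<min (?k s) (?l' s). ln (numC (I t))) / ln s - (\<Sum>t<?l s. ln (numC (I t))) / ln s)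
    + ((\<Sum>t<?l' s. ln (numN (I t))) / ln s - (\<Sum>t<min (?k s) (?l' s). ln (numN (I t))) / ln s)
    + ((\<Sum>t<?k' s. ln (numB (I t))) / ln s - (\<Sum>t<max (?k s) (?l' s). ln (numB (I t))) / ln s)
    = scale_count (\<beta> * s) (\<beta>' * s powr a) / ln s) at_top"
    using eventually_gt_at_top[of 1]
  proof eventually_elim
    case (elim s)
    show ?case unfolding scale_count_def log_count_eq[OF levels_ordered[OF elim(1)]]
      using elim(2) by (simp add: add_divide_distrib diff_divide_distrib)
  qed
  with lim show ?thesis by (rule Lim_transform_eventually)
qed

text \<open>The 2 in \<open>2 / r\<close> halves the sides of the small rectangles, so that their
  diameter is at most \<open>r\<close>. \<open>efficient_cover\<close> applies with
  \<open>H = b\<close>, since \<open>radix\<close> overshoots the requested scale by at most a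
  factor \<open>b\<close>.\<close>

lemma cover_ball:
  fixes R r :: real
  assumes "0 < r" "r \<le> R" "R < 1"
  shows "\<exists>C. finite C \<and> ball x R \<inter> limit_set \<subseteq> \<Union>C \<and> (\<forall>U\<in>C. bounded U \<and> diameter U \<le> r) \<and>
     real (card C) \<le> real ((2 * b + 2)^2) * exp (scale_count (1 / R) (2 / r))"
proof -
  have le: "1 / R \<le> 2 / r" using assms by (simp add: field_simps)
  have R1: "1 \<le> 1 / R" using assms by simp
  obtain C where C: "finite C" "ball x R \<inter> limit_set \<subseteq> \<Union>C" "\<forall>U\<in>C. bounded U \<and> diameter U \<le> r"
     "card C \<le> (2 * b + 2)^2 * (\<Prod>t<level m (2 / r). branching (level n (1 / R)) (level m (1 / R)) (level n (2 / r)) t)"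
    using efficient_cover[OF levels_ordered[OF le], of R b r x] assms
      radix_level_le[of m b "1 / R", OF m_ge m_le R1] radix_level_le[of n b "1 / R", OF n_ge n_le R1]
      le_radix_level[of m "2 / r", OF m_ge] le_radix_level[of n "2 / r", OF n_ge]
    by (auto simp: field_simps)
  have "real (card C) \<le> real ((2 * b + 2)^2 * (\<Prod>t<level m (2 / r). branching (level n (1 / R)) (level m (1 / R)) (level n (2 / r)) t))"
    using C(4) by (simp only: of_nat_le_iff)
  also have "\<dots> = real ((2 * b + 2)^2) * exp (scale_count (1 / R) (2 / r))"
    by (simp only: scale_count_def exp_log_count of_nat_mult)
  finally show ?thesis using C by blast
qed

lemma cover_number_ball_le:
  fixes R r :: real
  assumes "0 < r" "r \<le> R" "R < 1"
  shows "real (cover_number (ball x R \<inter> limit_set) r) \<le> real ((2 * b + 2)^2) * exp (scale_count (1 / R) (2 / r))"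
proof -
  obtain C where C: "finite C" "ball x R \<inter> limit_set \<subseteq> \<Union>C" "\<forall>U\<in>C. bounded U \<and> diameter U \<le> r"
     "real (card C) \<le> real ((2 * b + 2)^2) * exp (scale_count (1 / R) (2 / r))"
    using cover_ball[OF assms] by blast
  have "cover_number (ball x R \<inter> limit_set) r \<le> card C" using C by (intro cover_number_le) auto
  thus ?thesis using C(4) by linarith
qed

text \<open>The 3 in \<open>3 / R\<close> makes the cells short enough for the points to share a
  ball of radius \<open>R\<close>; \<open>3 * r \<le> R\<close> keeps the two scales in
  order.\<close>

lemma cover_number_ball_ge:
  fixes R r :: real
  assumes "0 < r" "3 * r \<le> R" "R < 1"
  shows "\<exists>x\<in>limit_set. exp (scale_count (3 / R) (1 / r)) \<le>
     real ((b + 2)^2) * real (cover_number (ball x R \<inter> limit_set) r)"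
proof -
  have le: "3 / R \<le> 1 / r" using assms by (simp add: field_simps)
  have r1: "1 \<le> 1 / r" using assms by simp
  obtain x where x: "x \<in> limit_set" "\<And>C. finite C \<Longrightarrow> ball x R \<inter> limit_set \<subseteq> \<Union>C \<Longrightarrow> (\<forall>U\<in>C. bounded U \<and> diameter U \<le> r) \<Longrightarrow>
     (\<Prod>t<level m (1 / r). branching (level n (3 / R)) (level m (3 / R)) (level n (1 / r)) t) \<le> (b + 2)^2 * card C"
    using every_cover_large[OF levels_ordered[OF le], of R r b] assms
      radix_level_le[of m b "1 / r", OF m_ge m_le r1] radix_level_le[of n b "1 / r", OF n_ge n_le r1]
      le_radix_level[of m "3 / R", OF m_ge] le_radix_level[of n "3 / R", OF n_ge]
    by (auto simp: field_simps)
  \<comment> \<open>Some finite cover must exist before the minimal one can be taken.\<close>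
  obtain C0 where "finite C0" "ball x R \<inter> limit_set \<subseteq> \<Union>C0" "\<forall>U\<in>C0. bounded U \<and> diameter U \<le> r"
    using cover_ball[of r R x] assms by auto
  then obtain C where C: "finite C" "card C = cover_number (ball x R \<inter> limit_set) r"
     "ball x R \<inter> limit_set \<subseteq> \<Union>C" "\<forall>U\<in>C. bounded U \<and> diameter U \<le> r"
    using cover_number_attained[of C0 "ball x R \<inter> limit_set" r] by auto
  have "exp (scale_count (3 / R) (1 / r)) \<le> real ((b + 2)^2 * card C)"
    unfolding scale_count_def exp_log_count of_nat_le_iff by (rule x(2)) (use C in auto)
  thus ?thesis using C(2) x(1) by (intro bexI[of _ x]) simp_all
qed

text \<open>A crude bound with a factor of at most \<open>b * b\<close> per level. It serves the
  radii away from 0, about which the limit says nothing.\<close>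

lemma scale_count_bounded:
  assumes "s' \<le> s0" shows "scale_count s s' \<le> real (level m s0) * ln (real (b * b))"
proof -
  have b: "b > 0" using n_le[of 0] n_pos[of 0] by simp
  have "scale_count s s' \<le> (\<Sum>t<level m s'. ln (real (b * b)))"
    unfolding scale_count_def log_count_def
  proof (intro sum_mono)
    fix t
    let ?g = "branching (level n s) (level m s) (level n s') t"
    have "0 < ?g" using branching_pos[of "level n s" "level m s" "level n s'" t] by simp
    thus "ln (real ?g) \<le> ln (real (b * b))"
      using branching_le by (subst ln_le_cancel_iff) (use b in \<open>auto simp del: of_nat_mult\<close>)
  qed
  also have "\<dots> = real (level m s') * ln (real (b * b))" by simp
  also have "\<dots> \<le> real (level m s0) * ln (real (b * b))"
    using level_mono[of m s' s0, OF m_ge assms] b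
    by (intro mult_right_mono) (auto simp: Suc_le_eq simp del: of_nat_mult intro!: ln_ge_zero)
  finally show ?thesis .
qed

lemma scale_count_nonneg: "0 \<le> scale_count s s'"
  unfolding scale_count_def by (rule log_count_nonneg)

end

section \<open>From the counts to the Assouad spectrum\<close>

context grid_sequence
begin

text \<open>With \<open>s = 1 / R\<close>, the logarithm of \<open>R / R powr (1 / \<theta>)\<close>
  is \<open>(1 / \<theta> - 1) * ln s\<close>, while the largest covering number has logarithm
  \<open>D * ln s\<close> up to lower order, so the critical exponent is the quotient. The constants
  \<beta> and \<beta>' absorb the 2 of the upper and the 3 of the lower covering estimate.\<close>

lemma assouad_spectrum_eqI:
  assumes \<theta>: "0 < \<theta>" "\<theta> < 1"
    and lim: "\<And>\<beta> \<beta>'. \<beta> > 0 \<Longrightarrow> \<beta>' > 0 \<Longrightarrow>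
      ((\<lambda>s. scale_count (\<beta> * s) (\<beta>' * s powr (1 / \<theta>)) / ln s) \<longlongrightarrow> D) at_top"
  shows "assouad_spectrum \<theta> limit_set = D / (1 / \<theta> - 1)"
proof -
  define a where "a = 1 / \<theta>"
  have a: "a > 1" using \<theta> by (simp add: a_def)
  note lim = lim[folded a_def]
  define A where "A = {\<alpha>. \<exists>c>0. \<forall>R. 0 < R \<and> R < 1 \<longrightarrow> (\<forall>x\<in>limit_set.
      real (cover_number (ball x R \<inter> limit_set) (R powr a)) \<le> c * (R / R powr a) powr \<alpha>)}"
  have pow: "(R / R powr a) powr \<alpha> = exp (\<alpha> * (a - 1) * ln (1 / R))" if "0 < R" for R \<alpha> :: real
  proof -
    have "ln (R / R powr a) = (a - 1) * ln (1 / R)"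
      using that by (simp add: ln_div ln_powr algebra_simps)
    thus ?thesis using that by (simp add: powr_def)
  qed
  have small: "0 < R powr a" "R powr a \<le> R" if "0 < R" "R < 1" for R
    using that powr_mono'[of 1 a R] a by auto
  have inv: "c / R powr a = c * (1 / R) powr a" if "0 < R" for R c :: real
    using that by (simp add: powr_divide)
  \<comment> \<open>This makes \<open>\<alpha> * (a - 1)\<close> nonnegative for \<alpha> above the
    critical value, so that one constant can absorb all large radii.\<close>
  have D: "D \<ge> 0"
    by (rule tendsto_lowerbound[OF lim[of 1 1]])
       (auto intro!: eventually_mono[OF eventually_gt_at_top[of 1]] divide_nonneg_nonneg scale_count_nonneg)
  have upper: "\<alpha> \<in> A" if \<alpha>: "D / (a - 1) < \<alpha>" for \<alpha>
  proof -
    have D\<alpha>: "D < \<alpha> * (a - 1)" using \<alpha> a by (simp add: field_simps)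
    hence \<alpha>0: "0 \<le> \<alpha> * (a - 1)" using D by linarith
    obtain s1 where s1: "\<And>s. s \<ge> s1 \<Longrightarrow> scale_count (1 * s) (2 * s powr a) / ln s < \<alpha> * (a - 1)"
      using order_tendstoD(2)[OF lim[of 1 2] D\<alpha>] unfolding eventually_at_top_linorder by auto
    \<comment> \<open>From \<open>s0\<close> on the limit controls the count; below
      \<open>s0\<close> it is at most the constant \<open>B0\<close>.\<close>
    define s0 where "s0 = max s1 2"
    define B0 where "B0 = real (level m (2 * s0 powr a)) * ln (real (b * b))"
    have B0: "B0 \<ge> 0"
      using scale_count_nonneg[of 0 "2 * s0 powr a"] scale_count_bounded[of "2 * s0 powr a" "2 * s0 powr a" 0]
      unfolding B0_def by linarith
    have bound: "scale_count s (2 * s powr a) \<le> B0 + \<alpha> * (a - 1) * ln s" if s: "s > 1" for s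
    proof (cases "s \<ge> s0")
      case True
      hence "scale_count (1 * s) (2 * s powr a) / ln s < \<alpha> * (a - 1)" by (intro s1) (simp add: s0_def)
      hence "scale_count s (2 * s powr a) < \<alpha> * (a - 1) * ln s" using s by (simp add: divide_less_eq)
      thus ?thesis using B0 by linarith
    next
      case False
      hence "2 * s powr a \<le> 2 * s0 powr a" using s a by (auto intro!: powr_mono2)
      hence "scale_count s (2 * s powr a) \<le> B0" unfolding B0_def by (rule scale_count_bounded)
      moreover have "0 \<le> \<alpha> * (a - 1) * ln s" using \<alpha>0 s by (intro mult_nonneg_nonneg[OF \<alpha>0]) auto
      ultimately show ?thesis by linarith
    qed
    define K where "K = real ((2 * b + 2)^2)"
    have K: "K > 0" by (simp add: K_def del: of_nat_power)
    show ?thesis unfolding A_def mem_Collect_eq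
    proof (intro exI[of _ "K * exp B0"] conjI allI impI ballI)
      fix R :: real and x assume R: "0 < R \<and> R < 1"
      have "real (cover_number (ball x R \<inter> limit_set) (R powr a)) \<le> K * exp (scale_count (1 / R) (2 / R powr a))"
        unfolding K_def using R small[of R] by (intro cover_number_ball_le) auto
      also have "\<dots> \<le> K * exp (B0 + \<alpha> * (a - 1) * ln (1 / R))"
        using bound[of "1 / R"] R K by (simp add: inv[of R])
      also have "\<dots> = K * exp B0 * (R / R powr a) powr \<alpha>"
        using R by (simp add: pow exp_add)
      finally show "real (cover_number (ball x R \<inter> limit_set) (R powr a)) \<le> K * exp B0 * (R / R powr a) powr \<alpha>" .
    qed (use K in simp)
  qed
  have lower: "D / (a - 1) \<le> \<alpha>" if \<alpha>: "\<alpha> \<in> A" for \<alpha>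
  proof -
    obtain c where c: "c > 0" "\<And>R x. 0 < R \<Longrightarrow> R < 1 \<Longrightarrow> x \<in> limit_set \<Longrightarrow>
      real (cover_number (ball x R \<inter> limit_set) (R powr a)) \<le> c * (R / R powr a) powr \<alpha>"
      using \<alpha> unfolding A_def by blast
    define K where "K = real ((b + 2)^2)"
    have K: "K > 0" by (simp add: K_def del: of_nat_power)
    have "D \<le> \<alpha> * (a - 1)"
    \<comment> \<open>Dividing the logarithm of the lower estimate by \<open>ln s\<close> makes the
      contribution of \<open>K * c\<close> vanish.\<close>
    proof (rule tendsto_le[OF _ _ lim[of 3 1]])
      show "((\<lambda>s. ln (K * c) / ln s + \<alpha> * (a - 1)) \<longlongrightarrow> \<alpha> * (a - 1)) at_top"
        by real_asymp
      have "eventually (\<lambda>s. 3 * (1 / s) powr a \<le> 1 / s) at_top" using a by real_asymp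
      thus "eventually (\<lambda>s. scale_count (3 * s) (1 * s powr a) / ln s \<le> ln (K * c) / ln s + \<alpha> * (a - 1)) at_top"
        using eventually_gt_at_top[of 1]
      proof eventually_elim
        case (elim s)
        define R where "R = 1 / s"
        have R: "0 < R" "R < 1" "s = 1 / R" using elim by (auto simp: R_def)
        obtain x where x: "x \<in> limit_set" "exp (scale_count (3 / R) (1 / R powr a)) \<le>
             K * real (cover_number (ball x R \<inter> limit_set) (R powr a))"
          unfolding K_def using cover_number_ball_ge[of "R powr a" R] small[OF R(1,2)] elim R by auto
        note x(2)
        also have "\<dots> \<le> K * (c * (R / R powr a) powr \<alpha>)"
          using c(2)[OF R(1,2) x(1)] K by simp
        also have "\<dots> = exp (ln (K * c) + \<alpha> * (a - 1) * ln s)"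
          using K c(1) R by (simp add: pow exp_add)
        finally have "scale_count (3 * s) (1 * s powr a) \<le> ln (K * c) + \<alpha> * (a - 1) * ln s"
          using R by (simp add: inv[of R])
        hence "scale_count (3 * s) (1 * s powr a) / ln s \<le> (ln (K * c) + \<alpha> * (a - 1) * ln s) / ln s"
          using elim(2) by (intro divide_right_mono) auto
        thus ?case using elim(2) by (simp add: add_divide_distrib)
      qed
    qed auto
    thus ?thesis using a by (simp add: field_simps)
  qed
  have "Inf A = D / (a - 1)"
  proof (rule antisym)
    have bdd: "bdd_below A" using lower by (rule bdd_belowI)
    \<comment> \<open>Every exponent above the critical one lies in \<open>A\<close>; whether the
      critical one does is left open.\<close>
    show "Inf A \<le> D / (a - 1)"
      by (rule dense_ge) (rule cInf_lower[OF upper bdd])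
    have "A \<noteq> {}" using upper[of "D / (a - 1) + 1"] by auto
    thus "D / (a - 1) \<le> Inf A" by (rule cInf_greatest) (rule lower)
  qed
  thus ?thesis unfolding assouad_spectrum_def A_def a_def .
qed

end

section \<open>Evaluation of the formula for the random carpet\<close>

lemma carpet_eq_limit_set:
  assumes "grid_sequence (m \<circ> \<omega>) (n \<circ> \<omega>) (I \<circ> \<omega>) b"
  shows "carpet m n I \<omega> = grid_sequence.limit_set (m \<circ> \<omega>) (n \<circ> \<omega>) (I \<circ> \<omega>)"
proof -
  interpret grid_sequence "m \<circ> \<omega>" "n \<circ> \<omega>" "I \<circ> \<omega>" b by fact
  have pos: "0 < m (\<omega> t)" "0 < n (\<omega> t)" for t using m_pos[of t] n_pos[of t] by auto
  have "z \<in> carpet m n I \<omega> \<longleftrightarrow>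
      (\<forall>k. \<exists>w. (\<forall>t<k. w t \<in> I (\<omega> t)) \<and> z \<in> word_map m n \<omega> w k ` unit_square)" for z
    unfolding carpet_def by blast
  thus ?thesis
    unfolding limit_set_def mem_word_map_image[of m \<omega> n, OF pos] by (auto simp: set_eq_iff)
qed

text \<open>The case condition amounts to \<open>1 / \<mu>m \<le> 1 / \<theta> / \<mu>n\<close>: to
  leading order the rows of the subsquares reach at least as deep as the columns of the given
  square, and the levels in between contribute \<open>N\<close>.\<close>

lemma spectrum_value_small:
  fixes \<theta> \<mu>m \<mu>n B C N :: real
  assumes "0 < \<theta>" "\<theta> < 1" "0 < \<mu>m" "0 < \<mu>n" "\<theta> \<le> \<mu>m / \<mu>n"
  shows "((C * min (1 / \<mu>m) (1 / \<theta> / \<mu>n) - C * (1 / \<mu>n)) + (N * (1 / \<theta> / \<mu>n) - N * min (1 / \<mu>m) (1 / \<theta> / \<mu>n))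
     + (B * (1 / \<theta> / \<mu>m) - B * max (1 / \<mu>m) (1 / \<theta> / \<mu>n))) / (1 / \<theta> - 1) =
    1 / (1 - \<theta>) * ((B + \<theta> * C - \<theta> * N) / \<mu>m + (N - B - \<theta> * C) / \<mu>n)"
proof -
  have "1 / \<mu>m \<le> 1 / \<theta> / \<mu>n" using assms by (simp add: field_simps)
  hence "min (1 / \<mu>m) (1 / \<theta> / \<mu>n) = 1 / \<mu>m" "max (1 / \<mu>m) (1 / \<theta> / \<mu>n) = 1 / \<theta> / \<mu>n" by auto
  moreover have "1 / \<theta> - 1 = (1 - \<theta>) / \<theta>" using assms by (simp add: field_simps)
  moreover have "((C * (1 / \<mu>m) - C * (1 / \<mu>n)) + (N * (1 / \<theta> / \<mu>n) - N * (1 / \<mu>m))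
     + (B * (1 / \<theta> / \<mu>m) - B * (1 / \<theta> / \<mu>n))) * \<theta> = (B + \<theta> * C - \<theta> * N) / \<mu>m + (N - B - \<theta> * C) / \<mu>n"
    using assms by (simp add: field_simps)
  ultimately show ?thesis using assms by (simp add: divide_simps)
qed

text \<open>Minimum and maximum change places, the terms in \<open>N\<close> cancel, and
  \<open>1 / \<theta> - 1\<close> becomes a common factor.\<close>

lemma spectrum_value_large:
  fixes \<theta> \<mu>m \<mu>n B C N :: real
  assumes "0 < \<theta>" "\<theta> < 1" "0 < \<mu>m" "0 < \<mu>n" "\<not> \<theta> \<le> \<mu>m / \<mu>n"
  shows "((C * min (1 / \<mu>m) (1 / \<theta> / \<mu>n) - C * (1 / \<mu>n)) + (N * (1 / \<theta> / \<mu>n) - N * min (1 / \<mu>m) (1 / \<theta> / \<mu>n))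
     + (B * (1 / \<theta> / \<mu>m) - B * max (1 / \<mu>m) (1 / \<theta> / \<mu>n))) / (1 / \<theta> - 1) = B / \<mu>m + C / \<mu>n"
proof -
  have "1 / \<theta> / \<mu>n \<le> 1 / \<mu>m" using assms by (simp add: field_simps)
  hence "min (1 / \<mu>m) (1 / \<theta> / \<mu>n) = 1 / \<theta> / \<mu>n" "max (1 / \<mu>m) (1 / \<theta> / \<mu>n) = 1 / \<mu>m" by auto
  moreover have "((C * (1 / \<theta> / \<mu>n) - C * (1 / \<mu>n)) + (N * (1 / \<theta> / \<mu>n) - N * (1 / \<theta> / \<mu>n))
     + (B * (1 / \<theta> / \<mu>m) - B * (1 / \<mu>m))) = (B / \<mu>m + C / \<mu>n) * (1 / \<theta> - 1)"
    by (simp add: algebra_simps)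
  ultimately show ?thesis using assms by simp
qed

theorem theorem3p1:
  fixes L :: nat and m n :: "nat \<Rightarrow> nat" and I :: "nat \<Rightarrow> (nat \<times> nat) set"
    and p :: "nat \<Rightarrow> real"
  assumes mn: "\<And>i. i \<in> {1..L} \<Longrightarrow> 2 \<le> m i \<and> m i < n i"
    and I_sub: "\<And>i. i \<in> {1..L} \<Longrightarrow> I i \<subseteq> {..<m i} \<times> {..<n i}"
    and I_ne: "\<And>i. i \<in> {1..L} \<Longrightarrow> I i \<noteq> {}"
    and p_pos: "\<And>i. i \<in> {1..L} \<Longrightarrow> 0 < p i \<and> p i < 1"
    and p_sum: "(\<Sum>i\<in>{1..L}. p i) = 1"
  shows "AE \<omega> in bernoulli_measure L p. \<forall>\<theta>. 0 < \<theta> \<and> \<theta> < 1 \<longrightarrow>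
     assouad_spectrum \<theta> (carpet m n I \<omega>) =
       (let sm = (\<Sum>i\<in>{1..L}. p i * ln (real (m i)));
            sn = (\<Sum>i\<in>{1..L}. p i * ln (real (n i)));
            N = (\<lambda>i. real (numN (I i))); B = (\<lambda>i. real (numB (I i))); C = (\<lambda>i. real (numC (I i)))
        in if \<theta> \<le> sm / sn then
             1 / (1 - \<theta>) *
               ((\<Sum>i\<in>{1..L}. p i * ln (B i * C i powr \<theta> * N i powr (- \<theta>))) / sm
                + (\<Sum>i\<in>{1..L}. p i * ln (N i * (B i) powr (-1) * C i powr (- \<theta>))) / sn)
           else
             (\<Sum>i\<in>{1..L}. p i * ln (B i)) / sm + (\<Sum>i\<in>{1..L}. p i * ln (C i)) / sn)"
proof -
  define mean where "mean = (\<lambda>f::nat \<Rightarrow> real. \<Sum>i\<in>{1..L}. p i * f i)"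
  have mean_eq: "(\<Sum>i\<in>{1..L}. p i * f i) = mean f" for f
    by (simp add: mean_def)
  have gs: "grid_sequence (m \<circ> \<omega>) (n \<circ> \<omega>) (I \<circ> \<omega>) (Max (n ` {1..L}))" if "\<And>t. \<omega> t \<in> {1..L}" for \<omega>
    by unfold_locales (use that mn I_sub I_ne in \<open>auto intro!: Max_ge simp del: One_nat_def\<close>)
  \<comment> \<open>The constant word with letter \<open>i\<close> transfers the positivity facts of
    the locale to that letter.\<close>
  have count_pos: "0 < numN (I i)" "0 < numB (I i)" "0 < numC (I i)" if "i \<in> {1..L}" for i
    using grid_sequence.numN_pos[OF gs[of "\<lambda>_. i"]] grid_sequence.numB_pos[OF gs[of "\<lambda>_. i"]]
      grid_sequence.numC_pos[OF gs[of "\<lambda>_. i"]] that by auto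
  have mean_pos: "0 < mean f" if "\<And>i. i \<in> {1..L} \<Longrightarrow> 0 < f i" for f
  proof -
    have "{1..L} \<noteq> {}" using p_sum by (metis sum.empty zero_neq_one)
    thus ?thesis unfolding mean_def using that p_pos by (intro sum_pos mult_pos_pos) auto
  qed
  let ?B = "\<lambda>i. ln (real (numB (I i)))" and ?C = "\<lambda>i. ln (real (numC (I i)))" and ?N = "\<lambda>i. ln (real (numN (I i)))"
  let ?m = "\<lambda>i. ln (real (m i))" and ?n = "\<lambda>i. ln (real (n i))"
  have sm: "mean ?m > 0" by (rule mean_pos) (use mn in \<open>fastforce intro!: ln_gt_zero\<close>)
  have sn: "mean ?n > 0" by (rule mean_pos) (use mn in \<open>fastforce intro!: ln_gt_zero\<close>)
  have "AE \<omega> in bernoulli_measure L p. (\<forall>t. \<omega> t \<in> {1..L}) \<and>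
     (\<forall>f. (\<lambda>k. (\<Sum>t<k. f (\<omega> t)) / real k) \<longlonglongrightarrow> mean f)"
    unfolding mean_def by (rule AE_bernoulli_averages[OF less_imp_le p_sum]) (use p_pos in auto)
  thus ?thesis
  proof eventually_elim
    case (elim \<omega>)
    hence \<omega>: "\<And>t. \<omega> t \<in> {1..L}" and avg: "\<And>f. (\<lambda>k. (\<Sum>t<k. f (\<omega> t)) / real k) \<longlonglongrightarrow> mean f" by auto
    interpret grid_sequence "m \<circ> \<omega>" "n \<circ> \<omega>" "I \<circ> \<omega>" "Max (n ` {1..L})" by (rule gs[OF \<omega>])
    show ?case
    proof (intro allI impI, elim conjE)
      fix \<theta> :: real assume \<theta>: "0 < \<theta>" "\<theta> < 1"
      let ?D = "(mean ?C * min (1 / mean ?m) (1 / \<theta> / mean ?n) - mean ?C * (1 / mean ?n))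
        + (mean ?N * (1 / \<theta> / mean ?n) - mean ?N * min (1 / mean ?m) (1 / \<theta> / mean ?n))
        + (mean ?B * (1 / \<theta> / mean ?m) - mean ?B * max (1 / mean ?m) (1 / \<theta> / mean ?n))"
      have val: "assouad_spectrum \<theta> (carpet m n I \<omega>) = ?D / (1 / \<theta> - 1)"
        unfolding carpet_eq_limit_set[OF gs[OF \<omega>]]
      proof (rule assouad_spectrum_eqI[OF \<theta>])
        fix \<beta> \<beta>' :: real assume "\<beta> > 0" "\<beta>' > 0"
        thus "((\<lambda>s. scale_count (\<beta> * s) (\<beta>' * s powr (1 / \<theta>)) / ln s) \<longlongrightarrow> ?D) at_top"
          using \<theta> sm sn avg[of ?m] avg[of ?n] avg[of ?B] avg[of ?C] avg[of ?N]
          by (intro scale_count_asymp) auto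
      qed
      have mean_ln: "(\<Sum>i\<in>{1..L}. p i * ln (real (f i) * real (g i) powr u * real (h i) powr v))
          = mean (\<lambda>i. ln (real (f i))) + u * mean (\<lambda>i. ln (real (g i))) + v * mean (\<lambda>i. ln (real (h i)))"
        if "\<And>i. i \<in> {1..L} \<Longrightarrow> 0 < f i \<and> 0 < g i \<and> 0 < h i" for f g h :: "nat \<Rightarrow> nat" and u v
      proof -
        have "p i * ln (real (f i) * real (g i) powr u * real (h i) powr v)
            = p i * ln (real (f i)) + u * (p i * ln (real (g i))) + v * (p i * ln (real (h i)))"
          if i: "i \<in> {1..L}" for i
        proof -
          have "ln (real (f i) * real (g i) powr u * real (h i) powr v) = ln (real (f i)) + u * ln (real (g i)) + v * ln (real (h i))"
            using \<open>\<And>i. i \<in> {1..L} \<Longrightarrow> 0 < f i \<and> 0 < g i \<and> 0 < h i\<close>[OF i] by (simp add: ln_mult ln_powr)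
          thus ?thesis by (simp add: algebra_simps)
        qed
        hence "(\<Sum>i\<in>{1..L}. p i * ln (real (f i) * real (g i) powr u * real (h i) powr v))
          = (\<Sum>i\<in>{1..L}. p i * ln (real (f i)) + u * (p i * ln (real (g i))) + v * (p i * ln (real (h i))))"
          by (rule sum.cong[OF refl])
        thus ?thesis by (simp only: mean_def sum.distrib sum_distrib_left)
      qed
      have mean_small: "(\<Sum>i\<in>{1..L}. p i * ln (real (numB (I i)) * real (numC (I i)) powr \<theta> * real (numN (I i)) powr (- \<theta>)))
          = mean ?B + \<theta> * mean ?C - \<theta> * mean ?N"
        by (subst mean_ln) (use count_pos in auto)
      have mean_large: "(\<Sum>i\<in>{1..L}. p i * ln (real (numN (I i)) * real (numB (I i)) powr (- 1) * real (numC (I i)) powr (- \<theta>)))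
          = mean ?N - mean ?B - \<theta> * mean ?C"
        by (subst mean_ln) (use count_pos in auto)
      show "assouad_spectrum \<theta> (carpet m n I \<omega>) =
       (let sm = (\<Sum>i\<in>{1..L}. p i * ln (real (m i)));
            sn = (\<Sum>i\<in>{1..L}. p i * ln (real (n i)));
            N = (\<lambda>i. real (numN (I i))); B = (\<lambda>i. real (numB (I i))); C = (\<lambda>i. real (numC (I i)))
        in if \<theta> \<le> sm / sn then
             1 / (1 - \<theta>) *
               ((\<Sum>i\<in>{1..L}. p i * ln (B i * C i powr \<theta> * N i powr (- \<theta>))) / sm
                + (\<Sum>i\<in>{1..L}. p i * ln (N i * (B i) powr (-1) * C i powr (- \<theta>))) / sn)
           else
             (\<Sum>i\<in>{1..L}. p i * ln (B i)) / sm + (\<Sum>i\<in>{1..L}. p i * ln (C i)) / sn)"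
        unfolding Let_def val mean_small mean_large
        unfolding mean_eq
      proof (cases "\<theta> \<le> mean ?m / mean ?n")
        case True
        from spectrum_value_small[OF \<theta> sm sn this] True show "?D / (1 / \<theta> - 1) = (if \<theta> \<le> mean ?m / mean ?n
            then 1 / (1 - \<theta>) * ((mean ?B + \<theta> * mean ?C - \<theta> * mean ?N) / mean ?m + (mean ?N - mean ?B - \<theta> * mean ?C) / mean ?n)
            else mean ?B / mean ?m + mean ?C / mean ?n)" by (simp only: if_True)
      next
        case False
        from spectrum_value_large[OF \<theta> sm sn this] False show "?D / (1 / \<theta> - 1) = (if \<theta> \<le> mean ?m / mean ?n
            then 1 / (1 - \<theta>) * ((mean ?B + \<theta> * mean ?C - \<theta> * mean ?N) / mean ?m + (mean ?N - mean ?B - \<theta> * mean ?C) / mean ?n)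
            else mean ?B / mean ?m + mean ?C / mean ?n)" by (simp only: if_False)
      qed
    qed
  qed
qed

end
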